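(* Let $\bar c$, $H'$, $P$, $\Delta$ be as described below. Suppose $\bar\xi,\bar\xi'$ are adjacent vertices of $\Delta$ (joined by an edge of $\Delta$), both of type (1B), such that the lines from $\bar c$ through $\bar\xi,\bar\xi'$ meet $\operatorname{conv}(\frac12(d+\mathcal W))$ in the points $\bar u,\bar w$ respectively, where $u,w\in\mathcal W$, with $\bar u=\frac12(\bar a+\bar c)$, $\bar w=\frac12(\bar a'+\bar c)$ for null $\bar a,\bar a'\in\mathcal C$. Suppose $P^{-1}(\bar\xi\bar\xi')$ is a 2-dimensional face of $\operatorname{conv}(\frac12(d+\mathcal W))$ whose corresponding face of $\operatorname{conv}(\mathcal W)$ is a parallelogram, and that the four vertices of this parallelogram are the only elements of $\mathcal W$ in the face. Let $E$ be the affine 2-plane spanned by $P^{-1}(\bar\xi\bar\xi')$. Then $u$ and $w$ are adjacent vertices of the parallelogram; letting $v$ be the vertex adjacent to $u$ other than $w$, and $s$ the vertex adjacent to $w$ other than $u$, either (i) $\mathcal C\cap E=\{\bar c,\bar a,\bar a',\bar e\}$ where $\bar e$ is null, $\bar v=\frac12(\bar a+\bar e)$ and $\bar s=\frac12(\bar a'+\bar e)$; or (ii) $\bar v,\bar s\in\mathcal C$ and $J(\bar a,\bar v)=J(\bar a',\bar s)=J(\bar s,\bar v)=0$. Moreover, if none of $v,u,s,w$ is of type I, then (i) cannot occur.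
   Context: Setting: $G$ compact Lie group, $K\subset G$ closed, $G/K$ connected almost effective, isotropy representation $\mathfrak p=\mathfrak p_1\oplus\cdots\oplus\mathfrak p_r$ ($r\ge2$) with pairwise inequivalent $\mathbb R$-irreducible summands, $d_i=\dim\mathfrak p_i$, $d=(d_1,\dots,d_r)$, $n=\sum d_i$. The scalar curvature of the metric $e^{q_i}Q$ on $\mathfrak p_i$ is $S(q)=\sum_{w\in\mathcal W}A_we^{w\cdot q}$, $\mathcal W\subset\mathbb Z^r$ finite, $A_w\ne0$, each $w$ of type I (one entry $-1$), type II (one entry $1$, two entries $-1$) or type III (one entry $1$, one entry $-2$), other entries $0$; $A_w>0$ for type I and $<0$ otherwise. Assume $\dim\operatorname{conv}(\mathcal W)=r-1$. $J$ is the symmetric bilinear form with $J(p,p)=\frac1{n-1}(\sum p_i)^2-\sum p_i^2/d_i$; null means $J(\bar x,\bar x)=0$. $u=\sum_{\bar c\in\mathcal C}F_{\bar c}e^{\bar c\cdot q}$ ($\mathcal C$ finite, $F_{\bar c}\ne0$) is a superpotential: for every $\xi$, $\sum_{(\bar a,\bar c)\in\mathcal C^2,\ \bar a+\bar c=\xi}J(\bar a,\bar c)F_{\bar a}F_{\bar c}$ equals $A_w$ if $\xi=d+w$, $w\in\mathcal W$, and $0$ otherwise; $\mathcal C$ lies in $\mathcal H=\{\sum\bar x_i=\frac12(n-1)\}$. For $x$ with $\sum x_i=-1$ write $\bar x=\frac12(d+x)$. $\bar c$ is a null vertex of $\operatorname{conv}(\mathcal C)$ (it lies outside $\operatorname{conv}(\frac12(d+\mathcal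 W))$); $H'\subset\mathcal H$ is an affine hyperplane strictly separating $\bar c$ from $\operatorname{conv}(\frac12(d+\mathcal W))$; $P$ sends $\bar z$ to the intersection of the ray from $\bar c$ through $\bar z$ with $H'$; $\Delta$ is the image of $P$. A vertex $\bar\xi$ of $\Delta$ is of type (1B) if the line through $\bar c,\bar\xi$ meets $\operatorname{conv}(\frac12(d+\mathcal W))$ in a unique point $\bar x$ and there is a null $\bar a\in\mathcal C$ with $\frac12(\bar a+\bar c)=\bar x$. *)

theory Defs
  imports "HOL-Analysis.Analysis"
begin

text \<open>Vectors in R^r are modelled as real^'r with 'r a finite index type (r = CARD('r)).
  The dimension vector d = (d_1,...,d_r) is a vector with positive integer entries.\<close>

definition dimn :: "real^'r \<Rightarrow> real" where
  "dimn d = (\<Sum>i\<in>UNIV. d $ i)"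

definition Jform :: "real^'r \<Rightarrow> real^'r \<Rightarrow> real^'r \<Rightarrow> real" where
  "Jform d p q = (\<Sum>i\<in>UNIV. p $ i) * (\<Sum>i\<in>UNIV. q $ i) / (dimn d - 1)
                 - (\<Sum>i\<in>UNIV. p $ i * q $ i / d $ i)"

definition null_vec :: "real^'r \<Rightarrow> real^'r \<Rightarrow> bool" where
  "null_vec d x \<longleftrightarrow> Jform d x x = 0"

definition barv :: "real^'r \<Rightarrow> real^'r \<Rightarrow> real^'r" where
  "barv d x = (1/2) *\<^sub>R (d + x)"

definition type_I :: "real^'r \<Rightarrow> bool" where
  "type_I w \<longleftrightarrow> (\<exists>i. w $ i = -1 \<and> (\<forall>j. j \<noteq> i \<longrightarrow> w $ j = 0))"

definition type_II :: "real^'r \<Rightarrow> bool" where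
  "type_II w \<longleftrightarrow> (\<exists>i j k. i \<noteq> j \<and> i \<noteq> k \<and> j \<noteq> k \<and>
      w $ i = 1 \<and> w $ j = -1 \<and> w $ k = -1 \<and>
      (\<forall>l. l \<noteq> i \<and> l \<noteq> j \<and> l \<noteq> k \<longrightarrow> w $ l = 0))"

definition type_III :: "real^'r \<Rightarrow> bool" where
  "type_III w \<longleftrightarrow> (\<exists>i j. i \<noteq> j \<and> w $ i = 1 \<and> w $ j = -2 \<and>
      (\<forall>l. l \<noteq> i \<and> l \<noteq> j \<longrightarrow> w $ l = 0))"

definition in_Hplane :: "real^'r \<Rightarrow> real^'r \<Rightarrow> bool" where
  "in_Hplane d x \<longleftrightarrow> (\<Sum>i\<in>UNIV. x $ i) = (dimn d - 1) / 2"

text \<open>u = sum_{c in C} F_c e^{c.q} is a superpotential for S = sum_{w in W} A_w e^{w.q}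
  (combinatorial characterisation from the paper).\<close>
definition is_superpotential ::
  "real^'r \<Rightarrow> (real^'r) set \<Rightarrow> (real^'r \<Rightarrow> real) \<Rightarrow> (real^'r) set \<Rightarrow> (real^'r \<Rightarrow> real) \<Rightarrow> bool" where
  "is_superpotential d W A C F \<longleftrightarrow>
     finite C \<and> (\<forall>c\<in>C. F c \<noteq> 0) \<and> (\<forall>c\<in>C. in_Hplane d c) \<and>
     (\<forall>\<xi>. (\<Sum>p\<in>{p\<in>C \<times> C. fst p + snd p = \<xi>}. Jform d (fst p) (snd p) * F (fst p) * F (snd p))
          = (if \<xi> - d \<in> W then A (\<xi> - d) else 0))"

text \<open>Central projection from c onto the hyperplane H' = \<H> \<inter> {x. \<nu> \<bullet> x = \<beta>}:
  the intersection of the ray from c through z with H'.\<close>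
definition projP :: "real^'r \<Rightarrow> real^'r \<Rightarrow> real \<Rightarrow> real^'r \<Rightarrow> real^'r" where
  "projP c \<nu> \<beta> z = c + ((\<beta> - \<nu> \<bullet> c) / (\<nu> \<bullet> (z - c))) *\<^sub>R (z - c)"

definition type_1B ::
  "real^'r \<Rightarrow> (real^'r) set \<Rightarrow> (real^'r) set \<Rightarrow> real^'r \<Rightarrow> real^'r \<Rightarrow> bool" where
  "type_1B d C K c \<xi> \<longleftrightarrow>
     (\<exists>x. affine hull {c, \<xi>} \<inter> K = {x} \<and> (\<exists>a\<in>C. null_vec d a \<and> (1/2) *\<^sub>R (a + c) = x))"

definition parallelogram :: "'a::euclidean_space set \<Rightarrow> bool" where
  "parallelogram S \<longleftrightarrow> (\<exists>p1 p2 p3 p4. S = convex hull {p1, p2, p3, p4} \<and>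
       p1 + p3 = p2 + p4 \<and> aff_dim S = 2)"

definition adjacent_vertices :: "'a::euclidean_space set \<Rightarrow> 'a \<Rightarrow> 'a \<Rightarrow> bool" where
  "adjacent_vertices S x y \<longleftrightarrow> x extreme_point_of S \<and> y extreme_point_of S \<and> x \<noteq> y \<and>
       convex hull {x, y} face_of S"

end

theory Submission
  imports Defs
begin

text \<open>
  Restricted to vectors of coordinate sum zero, \<open>-J\<close> is positive definite, so two distinct null
  vectors of the superpotential support have \<open>J > 0\<close>, and a sum \<open>p + q\<close> that arises from only one
  unordered pair forces \<open>J p q = 0\<close> unless it is twice a point of \<open>1/2 (d + W)\<close>. The key step is a local
  statement at a null vertex \<open>m\<close>: among the \<open>y\<close> with \<open>J m y \<noteq> 0\<close>, one that is closest to \<open>m\<close> for a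
  supporting functional satisfies \<open>m + y \<in> d + W\<close>. Applied at \<open>c\<close> it shows that \<open>C\<close> and
  \<open>1/2 (d + W)\<close> span the same cone at \<open>c\<close>, so that the edge of \<open>\<Delta>\<close> cuts out a face of \<open>C\<close> lying in
  the plane \<open>E\<close>.

  In \<open>E\<close> use affine coordinates with \<open>c, a, a'\<close> at \<open>(0,0), (1,0), (0,1)\<close>; the bilinear form is then
  determined by three positive numbers. The second edge of the hull of \<open>C \<inter> E\<close> at \<open>a\<close> either
  is tangent to the null conic and contains \<open>v\<close>, or it contains the reflection \<open>e\<close> of \<open>a\<close> in \<open>v\<close>; the
  same holds at \<open>a'\<close> with \<open>s\<close>. If \<open>u, w\<close> were opposite corners, neither could happen. If \<open>e\<close>
  occurs, it is null and corner arguments at \<open>c\<close> and \<open>e\<close> exclude all further points. In the tangent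
  case \<open>v, s\<close> bound an edge, on which \<open>C\<close> is an arithmetic progression; a sign argument for the resulting
  recurrence shows that there are no interior points, hence \<open>J s v = 0\<close>.
\<close>

section \<open>Quadratic balance conditions\<close>

lemma finite_real_minimum:
  fixes g :: "'a \<Rightarrow> real"
  assumes "finite S" "S \<noteq> {}"
  obtains x where "x \<in> S" "\<And>y. y \<in> S \<Longrightarrow> g x \<le> g y"
proof -
  have "Min (g ` S) \<in> g ` S" using assms by (intro Min_in) auto
  then obtain x where x: "x \<in> S" "g x = Min (g ` S)" by (metis imageE)
  have "g x \<le> g y" if "y \<in> S" for y using that assms x(2) by simp
  then show ?thesis using that x(1) by blast
qed

lemma finite_real_maximum:
  fixes g :: "'a \<Rightarrow> real"
  assumes "finite S" "S \<noteq> {}"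
  obtains x where "x \<in> S" "\<And>y. y \<in> S \<Longrightarrow> g y \<le> g x"
proof (rule finite_real_minimum[OF assms, of "\<lambda>x. - g x"])
  fix x assume "x \<in> S" "\<And>y. y \<in> S \<Longrightarrow> - g x \<le> - g y"
  then show ?thesis using that[of x] by simp
qed

text \<open>For \<open>u = \<Sum> f x e^x\<close> this is the coefficient of \<open>e^\<xi>\<close>
  when \<open>J\<close> is evaluated on the gradient of \<open>u\<close>, that is, the left side of
  the superpotential equation at \<open>\<xi>\<close>.\<close>

definition pair_sum :: "('v::real_vector \<Rightarrow> 'v \<Rightarrow> real) \<Rightarrow> ('v \<Rightarrow> real) \<Rightarrow> 'v set \<Rightarrow> 'v \<Rightarrow> real" where
  "pair_sum J f D \<xi> = (\<Sum>p\<in>{p\<in>D \<times> D. fst p + snd p = \<xi>}. J (fst p) (snd p) * f (fst p) * f (snd p))"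

text \<open>Reindexing along \<open>map_prod h h\<close>. The map \<open>h\<close> is meant to be an
  affine parametrisation, which does not preserve sums; the separate map \<open>s\<close> carries
  \<open>p + q\<close> to \<open>h p + h q\<close>.\<close>

lemma pair_sum_vimage:
  fixes h s :: "'w::real_vector \<Rightarrow> 'v::real_vector"
  assumes "inj h" "D \<subseteq> range h" and hs: "\<And>p q. h p + h q = s (p + q)" and "inj s"
  shows "pair_sum (\<lambda>p q. J (h p) (h q)) (f \<circ> h) (h -` D) \<xi> = pair_sum J f D (s \<xi>)"
  unfolding pair_sum_def
proof (rule sum.reindex_cong[symmetric, of "map_prod h h"])
  show "inj_on (map_prod h h) {p \<in> h -` D \<times> h -` D. fst p + snd p = \<xi>}"
    using inj_on_subset[OF prod.inj_map[OF \<open>inj h\<close> \<open>inj h\<close>] subset_UNIV] .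
  show "{p \<in> D \<times> D. fst p + snd p = s \<xi>} = map_prod h h ` {p \<in> h -` D \<times> h -` D. fst p + snd p = \<xi>}"
  proof (intro equalityI subsetI)
    fix p assume p: "p \<in> {p \<in> D \<times> D. fst p + snd p = s \<xi>}"
    then obtain x y where xy: "fst p = h x" "snd p = h y" using assms(2) by force
    have "x + y = \<xi>" using p xy hs[of x y] \<open>inj s\<close> by (simp add: inj_eq)
    moreover have "p = map_prod h h (x, y)" using xy by (simp add: prod_eq_iff)
    ultimately show "p \<in> map_prod h h ` {p \<in> h -` D \<times> h -` D. fst p + snd p = \<xi>}"
      using p xy by (intro image_eqI[of _ _ "(x, y)"]) auto
  qed (auto simp: hs)
qed auto

lemma pair_sum_face:
  assumes "T \<subseteq> D" "x \<in> T" "y \<in> T" "x + y = \<xi>"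
    and face: "\<And>x y p q. x \<in> T \<Longrightarrow> y \<in> T \<Longrightarrow> p \<in> D \<Longrightarrow> q \<in> D \<Longrightarrow> p + q = x + y \<Longrightarrow> p \<in> T"
  shows "pair_sum J f T \<xi> = pair_sum J f D \<xi>"
proof -
  have "p \<in> T \<and> q \<in> T" if "p \<in> D" "q \<in> D" "p + q = \<xi>" for p q
    using face[OF assms(2,3), of p q] face[OF assms(2,3), of q p] that assms(4) by (simp add: add.commute)
  then have "{p \<in> T \<times> T. fst p + snd p = \<xi>} = {p \<in> D \<times> D. fst p + snd p = \<xi>}"
    using assms(1) by auto
  then show ?thesis by (simp add: pair_sum_def)
qed

text \<open>The superpotential equations without coordinates: \<open>M\<close> stands for
  \<open>d + W\<close>, the totals at which the sum may be nonzero. \<open>mid\<close> is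
  bilinearity in a form that survives affine changes of coordinates, and \<open>neg\<close> says
  that \<open>J\<close> is negative on nonzero differences of points of \<open>D\<close>.\<close>

locale balanced_set =
  fixes J :: "'v::real_vector \<Rightarrow> 'v \<Rightarrow> real" and D M :: "'v set" and f :: "'v \<Rightarrow> real"
  assumes fin: "finite D"
    and nz: "x \<in> D \<Longrightarrow> f x \<noteq> 0"
    and sym: "J x y = J y x"
    and mid: "p + q = x + y \<Longrightarrow> J z p + J z q = J z x + J z y"
    and neg: "x \<in> D \<Longrightarrow> y \<in> D \<Longrightarrow> x \<noteq> y \<Longrightarrow> J x x + J y y < 2 * J x y"
    and bal: "\<xi> \<notin> M \<Longrightarrow> pair_sum J f D \<xi> = 0"
begin

text \<open>Only \<open>(x, y)\<close> and \<open>(y, x)\<close> can contribute to the sum at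
  \<open>x + y\<close>; both terms equal \<open>J x y * f x * f y\<close>, and the weights do not
  vanish.\<close>

lemma unique_pair_zero:
  assumes "x \<in> D" "y \<in> D" "x + y \<notin> M"
    and uniq: "\<And>p q. p \<in> D \<Longrightarrow> q \<in> D \<Longrightarrow> p + q = x + y \<Longrightarrow> (p = x \<and> q = y) \<or> (p = y \<and> q = x) \<or> J p q = 0"
  shows "J x y = 0"
proof (rule ccontr)
  assume ne: "J x y \<noteq> 0"
  let ?g = "\<lambda>p. J (fst p) (snd p) * f (fst p) * f (snd p)"
  have "(\<Sum>p\<in>{p\<in>D \<times> D. fst p + snd p = x + y}. ?g p) = (\<Sum>p\<in>{(x,y),(y,x)}. ?g p)"
  proof (rule sum.mono_neutral_right)
    show "finite {p \<in> D \<times> D. fst p + snd p = x + y}"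
      using fin by auto
    show "{(x, y), (y, x)} \<subseteq> {p \<in> D \<times> D. fst p + snd p = x + y}"
      using assms by (auto simp: add.commute)
    show "\<forall>p\<in>{p \<in> D \<times> D. fst p + snd p = x + y} - {(x, y), (y, x)}. ?g p = 0"
      using uniq by fastforce
  qed
  also have "\<dots> \<noteq> 0"
    using ne nz[OF assms(1)] nz[OF assms(2)] sym[of y x] by (cases "x = y") auto
  finally show False using bal[OF assms(3)] by (simp add: pair_sum_def)
qed

lemma null_pair_pos:
  assumes "x \<in> D" "y \<in> D" "x \<noteq> y" "J x x = 0" "J y y \<ge> 0"
  shows "J x y > 0"
  using neg[OF assms(1-3)] assms(4,5) by linarith

text \<open>Take a minimiser \<open>x\<close> of \<open>J x x\<close>. If
  \<open>p + q = x + x\<close> with \<open>p \<noteq> q\<close>, then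
  \<open>4 J x x = J p p + 2 J p q + J q q\<close> exceeds \<open>2 (J p p + J q q)\<close>, against
  minimality. So the total \<open>x + x\<close> isolates the pair \<open>(x, x)\<close>, which
  forces \<open>J x x = 0\<close> outside \<open>M\<close>.\<close>

lemma J_nonneg:
  assumes "\<And>x. x \<in> D \<Longrightarrow> x + x \<in> M \<Longrightarrow> J x x \<ge> 0" and "y \<in> D"
  shows "J y y \<ge> 0"
proof -
  obtain x where xD: "x \<in> D" and min: "\<And>p. p \<in> D \<Longrightarrow> J x x \<le> J p p"
    using finite_real_minimum[OF fin, of "\<lambda>x. J x x"] assms(2) by blast
  have "J x x \<ge> 0"
  proof (cases "x + x \<in> M")
    case True then show ?thesis using assms(1) xD by blast
  next
    case False
    have "J x x = 0"
    proof (rule unique_pair_zero[OF xD xD False])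
      fix p q assume pq: "p \<in> D" "q \<in> D" "p + q = x + x"
      have "p = q"
      proof (rule ccontr)
        assume "p \<noteq> q"
        then have "J p p + J q q < 2 * J p q" using neg pq by blast
        moreover have "J x p + J x q = J x x + J x x" "J p p + J p q = J p x + J p x" "J q p + J q q = J q x + J q x"
          using mid[OF pq(3)] by auto
        ultimately show False using min[OF pq(1)] min[OF pq(2)] sym[of p x] sym[of q x] sym[of q p] by linarith
      qed
      moreover from this have "(2::real) *\<^sub>R p = 2 *\<^sub>R x" using pq(3) by (simp add: scaleR_2)
      ultimately show "(p = x \<and> q = x) \<or> (p = x \<and> q = x) \<or> J p q = 0" by simp
    qed
    then show ?thesis by simp
  qed
  then show ?thesis using min[OF assms(2)] by linarith
qed

end

section \<open>Vertices of the support\<close>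

text \<open>A predicate rather than a linear functional, so that lexicographic orders are covered
  too; \<open>tangent_case\<close> uses one to pick a vertex.\<close>

definition additive_positive :: "('v::ab_group_add \<Rightarrow> bool) \<Rightarrow> bool" where
  "additive_positive Pos \<longleftrightarrow> \<not> Pos 0 \<and> (\<forall>x y. Pos x \<longrightarrow> Pos y \<longrightarrow> Pos (x + y))"

context balanced_set begin

text \<open>A sum of two positive displacements from \<open>m\<close> is never zero, so
  \<open>m + m\<close> has only the trivial decomposition.\<close>

lemma vertex_null_or_target:
  assumes "additive_positive Pos" "m \<in> D" and vert: "\<And>x. x \<in> D \<Longrightarrow> x \<noteq> m \<Longrightarrow> Pos (x - m)"
    and "m + m \<notin> M"
  shows "J m m = 0"
proof (rule unique_pair_zero[OF assms(2,2,4)])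
  fix p q assume pq: "p \<in> D" "q \<in> D" "p + q = m + m"
  have "p = m"
  proof (rule ccontr)
    assume "p \<noteq> m"
    moreover from this have "q \<noteq> m" using pq(3) by auto
    ultimately have "Pos (p - m)" "Pos (q - m)" using vert pq by auto
    then have "Pos ((p - m) + (q - m))" using assms(1) by (auto simp: additive_positive_def)
    moreover have "(p - m) + (q - m) = 0" using pq(3) by (simp add: algebra_simps)
    ultimately show False using assms(1) by (auto simp: additive_positive_def)
  qed
  then show "(p = m \<and> q = m) \<or> (p = m \<and> q = m) \<or> J p q = 0" using pq by auto
qed

text \<open>Choose \<open>y\<close> minimal among the points with \<open>J m y \<noteq> 0\<close>.
  In any other decomposition \<open>m + y = p + q\<close> both \<open>p\<close> and \<open>q\<close>
  lie strictly below \<open>y\<close>, because \<open>y - p = q - m\<close> and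
  \<open>y - q = p - m\<close>. Hence \<open>J m p = J m q = 0\<close>, while their sum is
  \<open>J m m + J m y = J m y\<close>; this is impossible, so \<open>m + y\<close> isolates its
  pair and must lie in \<open>M\<close>.\<close>

lemma null_vertex_neighbour:
  assumes Pos: "additive_positive Pos" and "m \<in> D" and vert: "\<And>x. x \<in> D \<Longrightarrow> x \<noteq> m \<Longrightarrow> Pos (x - m)"
    and null: "J m m = 0" and ex: "y\<^sub>0 \<in> D" "J m y\<^sub>0 \<noteq> 0"
  obtains y where "y \<in> D" "J m y \<noteq> 0" "m + y \<in> M"
    "\<And>z. z \<in> D \<Longrightarrow> Pos (y - z) \<Longrightarrow> J m z = 0"
proof -
  let ?S = "{y\<in>D. J m y \<noteq> 0}"
  have irr: "\<not> Pos 0" and add: "\<And>x y. Pos x \<Longrightarrow> Pos y \<Longrightarrow> Pos (x + y)"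
    using Pos by (auto simp: additive_positive_def)
  have "\<exists>y\<in>?S. \<forall>z\<in>?S. z \<noteq> y \<longrightarrow> \<not> Pos (y - z)"
  proof (rule Finite_Set.bex_min_element)
    show "asymp_on ?S (\<lambda>z y. Pos (y - z))"
      using irr add by (intro asymp_onI) (metis add.commute add_diff_cancel diff_add_cancel right_minus_eq add_diff_eq)
    show "transp_on ?S (\<lambda>z y. Pos (y - z))"
      by (intro transp_onI) (metis add diff_add_cancel add_diff_eq)
  qed (use fin ex in auto)
  then obtain y where y: "y \<in> D" "J m y \<noteq> 0"
    and min0: "\<And>z. z \<in> D \<Longrightarrow> J m z \<noteq> 0 \<Longrightarrow> z \<noteq> y \<Longrightarrow> \<not> Pos (y - z)"
    by auto
  have min: "\<not> Pos (y - z)" if "z \<in> D" "J m z \<noteq> 0" for z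
    using min0[OF that] irr by (cases "z = y") auto
  have "m + y \<in> M"
  proof (rule ccontr)
    assume neg: "m + y \<notin> M"
    have "J m y = 0"
    proof (rule unique_pair_zero[OF assms(2) y(1)])
      fix p q assume pq: "p \<in> D" "q \<in> D" "p + q = m + y"
      show "(p = m \<and> q = y) \<or> (p = y \<and> q = m) \<or> J p q = 0"
      proof (rule ccontr)
        assume n: "\<not> ?thesis"
        have pm: "p \<noteq> m" using n pq(3) by auto
        have qm: "q \<noteq> m" using n pq(3) by (auto simp: add.commute)
        have "y - p = q - m" "y - q = p - m" using pq(3) by (simp_all add: algebra_simps)
        then have "Pos (y - p)" "Pos (y - q)" using vert pm qm pq by auto
        then have "J m p = 0" "J m q = 0" using min pq by blast+
        then show False using null mid[OF pq(3), of m] y(2) by simp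
      qed
    qed (use neg in auto)
    then show False using y by simp
  qed
  then show ?thesis using that y min by blast
qed

section \<open>Passage to coordinates and to faces\<close>

lemma vimage_balanced:
  fixes h s :: "'w::real_vector \<Rightarrow> 'v"
  assumes "inj h" "D \<subseteq> range h" and hs: "\<And>p q. h p + h q = s (p + q)" and "inj s"
  shows "balanced_set (\<lambda>p q. J (h p) (h q)) (h -` D) (s -` M) (f \<circ> h)"
proof
  show "finite (h -` D)" using finite_vimageI[OF fin \<open>inj h\<close>] .
  show "(f \<circ> h) x \<noteq> 0" if "x \<in> h -` D" for x using that nz by simp
  show "J (h x) (h y) = J (h y) (h x)" for x y by (rule sym)
  show "J (h z) (h p) + J (h z) (h q) = J (h z) (h x) + J (h z) (h y)" if "p + q = x + y" for p q x y z
    using that by (intro mid) (simp add: hs)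
  show "J (h x) (h x) + J (h y) (h y) < 2 * J (h x) (h y)" if "x \<in> h -` D" "y \<in> h -` D" "x \<noteq> y" for x y
    using that neg \<open>inj h\<close> by (simp add: inj_eq)
  show "pair_sum (\<lambda>p q. J (h p) (h q)) (f \<circ> h) (h -` D) \<xi> = 0" if "\<xi> \<notin> s -` M" for \<xi>
    using that pair_sum_vimage[OF assms] bal by simp
qed

text \<open>At a total of two points of \<open>T\<close> the face condition makes the sums over
  \<open>T\<close> and \<open>D\<close> agree; at any other total the sum over \<open>T\<close> is
  empty.\<close>

lemma face_balanced:
  assumes "T \<subseteq> D"
    and face: "\<And>x y p q. x \<in> T \<Longrightarrow> y \<in> T \<Longrightarrow> p \<in> D \<Longrightarrow> q \<in> D \<Longrightarrow> p + q = x + y \<Longrightarrow> p \<in> T"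
  shows "balanced_set J T M f"
proof
  show "finite T" using fin assms(1) finite_subset by blast
  show "f x \<noteq> 0" if "x \<in> T" for x using that nz assms(1) by blast
  show "J x y = J y x" for x y by (rule sym)
  show "J z p + J z q = J z x + J z y" if "p + q = x + y" for p q x y z using that by (rule mid)
  show "J x x + J y y < 2 * J x y" if "x \<in> T" "y \<in> T" "x \<noteq> y" for x y
    using that neg assms(1) by blast
  fix \<xi> assume \<xi>: "\<xi> \<notin> M"
  show "pair_sum J f T \<xi> = 0"
  proof (cases "{p \<in> T \<times> T. fst p + snd p = \<xi>} = {}")
    case True
    then show ?thesis by (simp only: pair_sum_def sum.empty)
  next
    case False
    then obtain x y where "x \<in> T" "y \<in> T" "x + y = \<xi>" by auto
    then have "pair_sum J f T \<xi> = pair_sum J f D \<xi>" by (rule pair_sum_face[OF assms(1) _ _ _ face])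
    then show ?thesis using bal[OF \<xi>] by simp
  qed
qed

lemma level_balanced:
  fixes l :: "'v \<Rightarrow> real"
  assumes "\<And>x y. l (x + y) = l x + l y" and le: "\<And>x. x \<in> D \<Longrightarrow> l x \<le> k"
  shows "balanced_set J {x\<in>D. l x = k} M f"
proof (rule face_balanced)
  fix x y p q assume a: "x \<in> {x\<in>D. l x = k}" "y \<in> {x\<in>D. l x = k}" "p \<in> D" "q \<in> D" "p + q = x + y"
  have "l p + l q = l x + l y" using assms(1) a(5) by metis
  then have "l p = k" using le[OF a(3)] le[OF a(4)] a(1,2) by auto
  then show "p \<in> {x\<in>D. l x = k}" using a by blast
qed auto

end

lemma additive_positiveI:
  fixes l :: "'v::ab_group_add \<Rightarrow> real"
  assumes "\<And>x y. l (x + y) = l x + l y"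
  shows "additive_positive (\<lambda>x. 0 < l x)"
proof -
  have "l 0 = 0" using assms[of 0 0] by simp
  then show ?thesis using assms by (simp add: additive_positive_def)
qed

section \<open>Balanced sets on an interval\<close>

text \<open>The equations \<open>eq\<close> are the balance conditions for weights at
  \<open>0, 1/N, ..., 1\<close>, normalised by a geometric factor. In degrees
  \<open>2 \<le> m \<le> N\<close> all mixed coefficients are positive, so the sign of
  \<open>H 1\<close> spreads to \<open>H 2, ..., H N\<close>, which the equation in degree
  \<open>2 * N - 2\<close> contradicts.\<close>

lemma no_terminating_recurrence:
  fixes H :: "nat \<Rightarrow> real"
  assumes "N \<ge> 2" "H 0 = 1" "H 1 = -1" "H N \<noteq> 0" and beyond: "\<And>i. i > N \<Longrightarrow> H i = 0"
    and eq: "\<And>m. 1 \<le> m \<Longrightarrow> m < 2 * N \<Longrightarrow>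
      (\<Sum>i\<le>m. (real m - 1 - 2 * real i * real (m - i) / real N) * H i * H (m - i)) = 0"
  shows False
proof -
  let ?c = "\<lambda>m i. real m - 1 - 2 * real i * real (m - i) / real N"
  have N0: "real N > 0" using assms(1) by simp
  \<comment> \<open>For \<open>N = 2\<close> the mixed coefficient in degree 2 is
    \<open>1 - 2 / 2 = 0\<close>, so the equation reads \<open>2 * H 2 = 0\<close>.\<close>
  have N3: "N \<ge> 3"
  proof (rule ccontr)
    assume "\<not> N \<ge> 3"
    then have N2: "N = 2" using assms(1) by simp
    have "{..2::nat} = {0,1,2}" by auto
    then have "2 * H 2 = 0" using eq[of 2] assms(2,3) N2 by simp
    then show False using assms(4) N2 by simp
  qed
  have cpos: "?c m i > 0" if "2 \<le> m" "m \<le> N" "0 < i" "i < m" for m i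
  proof -
    \<comment> \<open>Since \<open>m \<le> N\<close>, dividing by \<open>m\<close> only enlarges the
      subtracted term, and \<open>4 * x * y \<le> (x + y)^2\<close> bounds it by
      \<open>m / 2 < m - 1\<close> for \<open>m \<ge> 3\<close>. The case \<open>m = 2\<close> rests
      on \<open>N \<ge> 3\<close>.\<close>
    have le: "2 * real i * real (m - i) / real N \<le> 2 * real i * real (m - i) / real m"
      using that by (intro divide_left_mono) auto
    define x where "x = real i"
    define y where "y = real (m - i)"
    have xy: "real m = x + y" "x \<ge> 1" "y \<ge> 1" using that by (auto simp: x_def y_def)
    show ?thesis
    proof (cases "m = 2")
      case True
      then have "i = 1" using that by simp
      then show ?thesis using True N3 by (simp add: field_simps)
    next
      case False
      then have m3: "x + y \<ge> 3" using that xy(1) by simp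
      have "4 * (x * y) \<le> (x + y)^2" using zero_le_power2[of "x - y"] by (simp add: power2_eq_square algebra_simps)
      moreover have "(x + y)^2 < 2 * (x + y - 1) * (x + y)"
      proof -
        have "(x + y) * (x + y) < (2 * (x + y - 1)) * (x + y)"
          using m3 by (intro mult_strict_right_mono) auto
        then show ?thesis by (simp add: power2_eq_square)
      qed
      ultimately have "2 * x * y < (x + y - 1) * (x + y)" by linarith
      then have "2 * x * y / (x + y) < x + y - 1" using m3 by (simp add: divide_less_eq)
      then show ?thesis using le by (simp add: x_def[symmetric] y_def[symmetric] xy(1)[symmetric])
    qed
  qed
  have Hneg: "H m < 0" if "1 \<le> m" "m \<le> N" for m
    using that
  proof (induction m rule: less_induct)
    case (less m)
    show ?case
    proof (cases "m = 1")
      case True then show ?thesis using assms(3) by simp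
    next
      case False
      then have m2: "m \<ge> 2" using less.prems by simp
      let ?t = "\<lambda>i. ?c m i * H i * H (m - i)"
      \<comment> \<open>Both end terms equal \<open>(m - 1) * H m\<close> because
        \<open>H 0 = 1\<close>; each middle term is a positive coefficient times a product of two
        negative values.\<close>
      have "{..m} = insert 0 (insert m {0<..<m})" using m2 by auto
      then have "(\<Sum>i\<le>m. ?t i) = ?t 0 + (?t m + (\<Sum>i\<in>{0<..<m}. ?t i))"
        using m2 by simp
      moreover have "(\<Sum>i\<in>{0<..<m}. ?t i) > 0"
      proof (rule sum_pos)
        have "1 \<in> {0<..<m}" using m2 by simp
        then show "{0<..<m} \<noteq> {}" by blast
        fix i assume i: "i \<in> {0<..<m}"
        have "H i < 0" "H (m - i) < 0" using less.IH i less.prems by auto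
        then have "H i * H (m - i) > 0" by (rule mult_neg_neg)
        then show "?t i > 0" using cpos[OF m2 less.prems(2), of i] i
          by (metis greaterThanLessThan_iff mult.assoc mult_pos_pos)
      qed simp
      moreover have "(\<Sum>i\<le>m. ?t i) = 0" using eq[of m] less.prems assms(1) by simp
      ultimately have "2 * (real m - 1) * H m < 0" using assms(2) by (simp add: algebra_simps)
      then show ?thesis using m2 by (simp add: mult_less_0_iff)
    qed
  qed
  \<comment> \<open>All of \<open>H 1, \<dots>, H N\<close> being negative is incompatible with the second equation from the top.\<close>
  define m where "m = 2 * N - 2"
  let ?t = "\<lambda>i. ?c m i * H i * H (m - i)"
  have "(\<Sum>i\<le>m. ?t i) = (\<Sum>i\<in>{N-2,N-1,N}. ?t i)"
  proof (rule sum.mono_neutral_right)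
    show "\<forall>i\<in>{..m} - {N-2,N-1,N}. ?t i = 0"
    proof
      fix i assume "i \<in> {..m} - {N-2,N-1,N}"
      then have "i > N \<or> m - i > N" using N3 unfolding m_def by auto
      then show "?t i = 0" using beyond by auto
    qed
  qed (use N3 in \<open>auto simp: m_def\<close>)
  also have "\<dots> = ?t (N-2) + ?t (N-1) + ?t N"
  proof -
    have "N - 2 \<noteq> N - 1" "N - 2 \<noteq> N" "N - 1 \<noteq> N" using N3 by linarith+
    then show ?thesis by (simp only: sum.insert sum.empty finite.intros insert_iff empty_iff simp_thms add_0_right add.assoc)
  qed
  finally have total: "(\<Sum>i\<le>m. ?t i) = ?t (N-2) + ?t (N-1) + ?t N" .
  have terms: "?t (N-2) = H (N-2) * H N" "?t N = H (N-2) * H N"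
    "?t (N-1) = (real N - 2) / real N * (H (N-1))^2"
  proof -
    have eqs: "m - (N-2) = N" "m - (N-1) = N-1" "m - N = N-2" "real m = 2 * real N - 2"
      "real (N-2) = real N - 2" "real (N-1) = real N - 1"
      using N3 by (auto simp: m_def)
    show "?t (N-2) = H (N-2) * H N" "?t N = H (N-2) * H N"
      "?t (N-1) = (real N - 2) / real N * (H (N-1))^2"
      unfolding eqs using N0 by (simp_all add: field_simps power2_eq_square)
  qed
  have "(\<Sum>i\<le>m. ?t i) = 0" using eq[of m] N3 by (simp add: m_def)
  then have "2 * (H (N-2) * H N) + (real N - 2) / real N * (H (N-1))^2 = 0"
    using total unfolding terms by linarith
  moreover have "H (N-2) * H N > 0" using Hneg[of "N-2"] Hneg[of N] N3 by (intro mult_neg_neg) auto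
  moreover have "(real N - 2) / real N * (H (N-1))^2 \<ge> 0" using N3 by simp
  ultimately show False by linarith
qed

text \<open>Near \<open>0\<close> the balance condition forces the smallest positive element to be \<open>j / k\<close> and all
  others to be multiples of it; since \<open>1\<close> is one of them, \<open>j / k = 1 / N\<close>.\<close>
lemma balanced_unit_interval:
  fixes R :: "real set" and h :: "real \<Rightarrow> real" and j k :: real
  assumes bs: "balanced_set (\<lambda>s t. k * (s + t - 2 * s * t) - j) R {0, 2} h"
    and R: "R \<subseteq> {0..1}" "0 \<in> R" "1 \<in> R" and pos: "j > 0" "k > 0"
  shows "j = k"
proof (rule ccontr)
  assume jk: "j \<noteq> k"
  interpret balanced_set "\<lambda>s t. k * (s + t - 2 * s * t) - j" R "{0, 2}" h by fact
  define \<delta> where "\<delta> = j / k"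
  have jd: "j = k * \<delta>" and d0: "\<delta> > 0" using pos by (auto simp: \<delta>_def)
  \<comment> \<open>Such an \<open>x\<close> is paired only with \<open>0\<close> in the equation at
    \<open>x\<close>, where the form takes the value \<open>k * x - j\<close>.\<close>
  have step: "x = \<delta>" if x: "x \<in> R" "x > 0" and dec: "\<And>p q. p \<in> R \<Longrightarrow> q \<in> R \<Longrightarrow> p > 0 \<Longrightarrow> q > 0 \<Longrightarrow> p + q \<noteq> x" for x
  proof -
    have "k * (0 + x - 2 * 0 * x) - j = 0"
    proof (rule unique_pair_zero[OF R(2) x(1)])
      show "0 + x \<notin> {0, 2}" using x R by fastforce
      fix p q assume pq: "p \<in> R" "q \<in> R" "p + q = 0 + x"
      have "p \<ge> 0" "q \<ge> 0" using pq R by auto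
      then have "p = 0 \<or> q = 0" using dec[OF pq(1,2)] pq(3) by force
      then show "p = 0 \<and> q = x \<or> p = x \<and> q = 0 \<or> k * (p + q - 2 * p * q) - j = 0" using pq(3) by auto
    qed
    then show ?thesis using pos by (simp add: jd)
  qed
  have ap: "\<exists>n::nat. x = real n * \<delta>" if "x \<in> R" for x
  proof (rule ccontr)
    assume "\<not> ?thesis"
    then have "{x\<in>R. \<nexists>n::nat. x = real n * \<delta>} \<noteq> {}" (is "?B \<noteq> {}") using that by auto
    then obtain y where y: "y \<in> ?B" "\<And>z. z \<in> ?B \<Longrightarrow> y \<le> z"
      using finite_real_minimum[of ?B "\<lambda>x. x"] fin by auto
    have "y \<noteq> 0" using y(1) by (auto dest: spec[of _ 0])
    then have "y > 0" using y(1) R by force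
    have "y = \<delta>"
    proof (rule step)
      fix p q assume pq: "p \<in> R" "q \<in> R" "p > 0" "q > 0"
      show "p + q \<noteq> y"
      proof
        assume s: "p + q = y"
        then have "p \<notin> ?B" "q \<notin> ?B" using y(2)[of p] y(2)[of q] pq by linarith+
        then obtain n m :: nat where "p = real n * \<delta>" "q = real m * \<delta>" using pq by auto
        then have "y = real (n + m) * \<delta>" using s by (simp add: algebra_simps)
        then show False using y(1) by blast
      qed
    qed (use y \<open>y > 0\<close> in auto)
    then have "y = real (1::nat) * \<delta>" by simp
    then show False using y(1) by blast
  qed
  obtain N :: nat where N: "1 = real N * \<delta>" using ap[OF R(3)] by blast
  have "N \<noteq> 0" using N by (metis mult_zero_left of_nat_0 zero_neq_one)
  moreover have "N \<noteq> 1" using N jk by (auto simp: jd)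
  ultimately have N2: "N \<ge> 2" by simp
  then have dN: "\<delta> = 1 / real N" using N by (simp add: field_simps)
  have dR: "\<delta> \<in> R"
  proof -
    obtain x where x: "x \<in> R - {0}" "\<And>y. y \<in> R - {0} \<Longrightarrow> x \<le> y"
      using finite_real_minimum[of "R - {0}" "\<lambda>x. x"] fin R by (metis finite_Diff insert_Diff insert_iff singletonD zero_neq_one emptyE DiffI)
    have "x = \<delta>"
      using step[of x] x R by (metis (no_types, opaque_lifting) DiffD1 DiffE DiffI add_le_same_cancel1 atLeastAtMost_iff insertI1 insert_absorb leD le_less singletonD subsetD)
    then show ?thesis using x by simp
  qed
  \<comment> \<open>The value \<open>0\<close> off \<open>R\<close> lets the sum over pairs run over
    all \<open>i \<le> m\<close>.\<close>
  define G where "G n = (if real n * \<delta> \<in> R then h (real n * \<delta>) else 0)" for n :: nat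
  have G0: "G 0 \<noteq> 0" and G1: "G 1 \<noteq> 0" and GN: "G N \<noteq> 0"
    using nz R dR N by (auto simp: G_def)
  have Geq: "(\<Sum>i\<le>m. (real m - 1 - 2 * real i * real (m - i) / real N) * G i * G (m - i)) = 0"
    if "1 \<le> m" "m < 2 * N" for m
  proof -
    let ?g = "\<lambda>p. (k * (fst p + snd p - 2 * fst p * snd p) - j) * h (fst p) * h (snd p)"
    let ?I = "{i. i \<le> m \<and> real i * \<delta> \<in> R \<and> real (m - i) * \<delta> \<in> R}"
    \<comment> \<open>The totals \<open>0\<close> and \<open>2\<close> exempt from balance
      correspond to \<open>m = 0\<close> and \<open>m = 2 * N\<close>, whence the range of
      \<open>m\<close>.\<close>
    have "real m * \<delta> \<notin> {0, 2}"
    proof -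
      have "real m < 2 * real N" using that(2) by linarith
      then have "real m * \<delta> < 2" using N2 by (simp add: dN field_simps)
      then show ?thesis using d0 that by auto
    qed
    then have "(\<Sum>p\<in>{p\<in>R \<times> R. fst p + snd p = real m * \<delta>}. ?g p) = 0" using bal unfolding pair_sum_def by blast
    also have "(\<Sum>p\<in>{p\<in>R \<times> R. fst p + snd p = real m * \<delta>}. ?g p)
        = (\<Sum>i\<in>?I. ?g (real i * \<delta>, real (m - i) * \<delta>))"
    proof (rule sum.reindex_bij_betw[symmetric], rule bij_betw_imageI)
      show "inj_on (\<lambda>i. (real i * \<delta>, real (m - i) * \<delta>)) ?I" using d0 by (auto simp: inj_on_def)
      show "(\<lambda>i. (real i * \<delta>, real (m - i) * \<delta>)) ` ?I = {p \<in> R \<times> R. fst p + snd p = real m * \<delta>}"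
      proof (intro equalityI subsetI)
        fix p assume p: "p \<in> {p \<in> R \<times> R. fst p + snd p = real m * \<delta>}"
        have "fst p \<in> R" "snd p \<in> R" using p by auto
        then obtain i l :: nat where il: "fst p = real i * \<delta>" "snd p = real l * \<delta>"
          using ap by blast
        have "real (i + l) * \<delta> = real m * \<delta>" using p il by (simp add: algebra_simps)
        then have "real (i + l) = real m" using d0 by simp
        then have "i + l = m" by linarith
        then show "p \<in> (\<lambda>i. (real i * \<delta>, real (m - i) * \<delta>)) ` ?I"
          using il p by (intro image_eqI[of _ _ i]) (auto simp: prod_eq_iff)
      qed (auto simp: of_nat_diff algebra_simps)
    qed
    also have "\<dots> = (\<Sum>i\<in>?I. k * \<delta> * ((real m - 1 - 2 * real i * real (m - i) / real N) * G i * G (m - i)))"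
    proof (rule sum.cong)
      fix i assume i: "i \<in> ?I"
      have "real i * \<delta> + real (m - i) * \<delta> = real m * \<delta>" using i by (simp add: of_nat_diff algebra_simps)
      then have "k * (real i * \<delta> + real (m - i) * \<delta> - 2 * (real i * \<delta>) * (real (m - i) * \<delta>)) - j
         = k * \<delta> * (real m - 1 - 2 * real i * real (m - i) / real N)"
        by (simp add: jd) (simp add: dN algebra_simps)
      then show "?g (real i * \<delta>, real (m - i) * \<delta>)
        = k * \<delta> * ((real m - 1 - 2 * real i * real (m - i) / real N) * G i * G (m - i))"
        using i by (simp add: G_def del: of_nat_diff)
    qed simp
    also have "\<dots> = (\<Sum>i\<le>m. k * \<delta> * ((real m - 1 - 2 * real i * real (m - i) / real N) * G i * G (m - i)))"
      by (rule sum.mono_neutral_left) (auto simp: G_def)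
    also have "\<dots> = k * \<delta> * (\<Sum>i\<le>m. (real m - 1 - 2 * real i * real (m - i) / real N) * G i * G (m - i))"
      by (simp add: sum_distrib_left)
    finally show ?thesis using d0 pos by simp
  qed
  \<comment> \<open>Every term of degree \<open>m\<close> acquires the same factor
    \<open>\<rho> ^ m / (G 0)^2\<close>, so the equations persist; \<open>\<rho>\<close> is chosen
    to make \<open>H 1 = -1\<close>.\<close>
  define \<rho> where "\<rho> = - G 0 / G 1"
  define H where "H n = G n / G 0 * \<rho> ^ n" for n
  have \<rho>0: "\<rho> \<noteq> 0" using G0 G1 by (simp add: \<rho>_def)
  show False
  proof (rule no_terminating_recurrence[OF N2])
    show "H 0 = 1" "H 1 = -1" "H N \<noteq> 0" using G0 G1 GN \<rho>0 by (auto simp: H_def \<rho>_def)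
    show "H i = 0" if "i > N" for i
    proof -
      have "real i * \<delta> > 1" using that N2 by (simp add: dN)
      then show ?thesis using R by (auto simp: H_def G_def)
    qed
    fix m assume m: "1 \<le> m" "m < 2 * N"
    have "(\<Sum>i\<le>m. (real m - 1 - 2 * real i * real (m - i) / real N) * H i * H (m - i))
      = (\<Sum>i\<le>m. \<rho> ^ m / (G 0)^2 * ((real m - 1 - 2 * real i * real (m - i) / real N) * G i * G (m - i)))"
    proof (rule sum.cong)
      fix i assume "i \<in> {..m}"
      then have "\<rho> ^ m = \<rho> ^ i * \<rho> ^ (m - i)" by (simp add: power_add[symmetric])
      then show "(real m - 1 - 2 * real i * real (m - i) / real N) * H i * H (m - i)
        = \<rho> ^ m / (G 0)^2 * ((real m - 1 - 2 * real i * real (m - i) / real N) * G i * G (m - i))"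
        by (simp add: H_def power2_eq_square)
    qed simp
    also have "\<dots> = 0" by (simp only: sum_distrib_left[symmetric] Geq[OF m] mult_zero_right)
    finally show "(\<Sum>i\<le>m. (real m - 1 - 2 * real i * real (m - i) / real N) * H i * H (m - i)) = 0" .
  qed
qed

section \<open>Balanced sets in the plane\<close>

text \<open>The point \<open>(x,y)\<close> stands for \<open>c + x (a - c) + y (a' - c)\<close> with null vectors \<open>c, a, a'\<close>, and
  \<open>\<alpha>, \<beta>, \<gamma>\<close> for \<open>J c a, J c a', J a a'\<close>. A point \<open>\<zeta>\<close> of \<open>M\<close> encodes the element of \<open>1/2 (d + W)\<close> with
  coordinates \<open>\<zeta> / 2\<close>.\<close>
locale planar_set = balanced_set J D M f
  for J :: "real \<times> real \<Rightarrow> real \<times> real \<Rightarrow> real" and D M f +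
  fixes \<alpha> \<beta> \<gamma> :: real
  assumes Jf: "J p q = \<alpha> * ((1 - fst p - snd p) * fst q + fst p * (1 - fst q - snd q))
      + \<beta> * ((1 - fst p - snd p) * snd q + snd p * (1 - fst q - snd q))
      + \<gamma> * (fst p * snd q + snd p * fst q)"
    and quadrant: "p \<in> D \<Longrightarrow> 0 \<le> fst p \<and> 0 \<le> snd p"
    and corners: "(0,0) \<in> D" "(1,0) \<in> D" "(0,1) \<in> D"
    and axisM: "(x,0) \<in> M \<Longrightarrow> x = 1" "(0,y) \<in> M \<Longrightarrow> y = 1"
begin

section \<open>The support near the two axes, and the exclusion of opposite corners\<close>

lemma coefficients_pos: "\<alpha> > 0" "\<beta> > 0" "\<gamma> > 0"
  using neg[OF corners(1,2)] neg[OF corners(1,3)] neg[OF corners(2,3)] by (simp_all add: Jf)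

lemma J_origin_pos:
  assumes "p \<in> D" "p \<noteq> (0,0)"
  shows "J (0,0) p > 0"
proof -
  have "fst p > 0 \<or> snd p > 0" using quadrant[OF assms(1)] assms(2) by (cases p) auto
  then have "\<alpha> * fst p + \<beta> * snd p > 0"
    using coefficients_pos quadrant[OF assms(1)] by (auto intro: add_pos_nonneg add_nonneg_pos)
  then show ?thesis by (simp add: Jf)
qed

text \<open>In barycentric coordinates for the three null points the form has only mixed terms, all
  with positive coefficients.\<close>

lemma J_nonneg_triangle:
  assumes "0 \<le> fst p" "0 \<le> snd p" "fst p + snd p \<le> 1"
  shows "J p p \<ge> 0"
proof -
  define z where "z = 1 - fst p - snd p"
  have "z \<ge> 0" using assms z_def by simp
  moreover have "J p p = 2 * (\<alpha> * (z * fst p) + \<beta> * (z * snd p) + \<gamma> * (fst p * snd p))"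
    unfolding Jf z_def[symmetric] by (simp add: algebra_simps)
  ultimately show ?thesis using coefficients_pos assms by simp
qed

text \<open>The axis carries a face of \<open>D\<close>. Its far end \<open>(t,0)\<close> is null,
  so \<open>\<alpha> * t * (1 - t) = 0\<close> and \<open>t = 1\<close>. The neighbour of the origin
  on this face is \<open>(1,0)\<close>, the only point of \<open>M\<close> on the axis, so a point
  strictly between would be \<open>J\<close>-orthogonal to the origin, against
  \<open>J_origin_pos\<close>.\<close>

lemma x_axis:
  assumes "p \<in> D" "snd p = 0"
  shows "p = (0,0) \<or> p = (1,0)"
proof -
  let ?T = "{x\<in>D. - snd x = 0}"
  interpret T: balanced_set J ?T M f
    using quadrant by (intro level_balanced) auto
  have oT: "(0,0) \<in> ?T" and AT: "(1,0) \<in> ?T" using corners by auto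
  obtain m where m: "m \<in> ?T" "\<And>y. y \<in> ?T \<Longrightarrow> fst y \<le> fst m"
    using finite_real_minimum[OF T.fin, of "\<lambda>x. - fst x"] oT by auto
  obtain t where mt: "m = (t, 0)" using m(1) by (cases m) auto
  have t1: "t \<ge> 1" using m(2)[OF AT] mt by simp
  have "J m m = 0"
  proof (rule T.vertex_null_or_target[OF additive_positiveI[of "\<lambda>x. - fst x"] m(1)])
    show "0 < - fst (x - m)" if "x \<in> ?T" "x \<noteq> m" for x
      using that m by (cases x) (force simp: mt)
    show "m + m \<notin> M" using axisM(1)[of "t + t"] t1 mt by auto
  qed auto
  then have "\<alpha> * (t * (1 - t)) = 0" by (simp add: mt Jf algebra_simps)
  then have "t = 1" using coefficients_pos t1 by auto
  then have le1: "fst x \<le> 1" if "x \<in> ?T" for x using m(2)[OF that] mt by simp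
  have pT: "p \<in> ?T" using assms by simp
  obtain y where y: "y \<in> ?T" "J (0,0) y \<noteq> 0" "(0,0) + y \<in> M" "\<And>z. z \<in> ?T \<Longrightarrow> 0 < fst (y - z) \<Longrightarrow> J (0,0) z = 0"
  proof (rule T.null_vertex_neighbour[OF additive_positiveI[of fst] oT _ _ AT])
    show "0 < fst (x - (0,0))" if "x \<in> ?T" "x \<noteq> (0,0)" for x
      using that quadrant[of x] by (cases x) auto
    show "J (0,0) (1,0) \<noteq> 0" "J (0,0) (0,0) = 0" using coefficients_pos by (simp_all add: Jf)
  qed auto
  have "y = (1,0)" using y(1,3) axisM(1)[of "fst y"] by (cases y) auto
  show ?thesis
  proof (rule ccontr)
    assume n: "\<not> ?thesis"
    then have "fst p < 1" "fst p > 0" using le1[OF pT] assms quadrant[OF assms(1)] by (cases p; force)+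
    moreover from this have "J (0,0) p = 0" using y(4)[OF pT] \<open>y = (1,0)\<close> by simp
    moreover have "p \<noteq> (0,0)" using n by simp
    ultimately show False using J_origin_pos[OF assms(1)] by simp
  qed
qed

text \<open>Exchanging \<open>a\<close> and \<open>a'\<close> transfers every result at the first
  axis to the second.\<close>

lemma planar_swap:
  "planar_set (\<lambda>p q. J (prod.swap p) (prod.swap q)) (prod.swap ` D) (prod.swap ` M) (f \<circ> prod.swap) \<beta> \<alpha> \<gamma>"
proof (intro planar_set.intro planar_set_axioms.intro)
  have vim: "prod.swap ` X = prod.swap -` X" for X :: "(real \<times> real) set" by force
  show "balanced_set (\<lambda>p q. J (prod.swap p) (prod.swap q)) (prod.swap ` D) (prod.swap ` M) (f \<circ> prod.swap)"
    unfolding vim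
  proof (rule vimage_balanced)
    show "prod.swap p + prod.swap q = prod.swap (p + q)" for p q :: "real \<times> real"
      by (simp add: prod_eq_iff)
  qed auto
  show "(0,0) \<in> prod.swap ` D" "(1,0) \<in> prod.swap ` D" "(0,1) \<in> prod.swap ` D"
    using image_eqI[of _ prod.swap "(0,0)" D] image_eqI[of _ prod.swap "(0,1)" D]
      image_eqI[of _ prod.swap "(1,0)" D] corners by auto
qed (use quadrant axisM in \<open>auto simp: Jf algebra_simps image_iff\<close>)

lemma y_axis:
  assumes "p \<in> D" "fst p = 0"
  shows "p = (0,0) \<or> p = (0,1)"
proof -
  interpret s: planar_set "\<lambda>p q. J (prod.swap p) (prod.swap q)" "prod.swap ` D" "prod.swap ` M" "f \<circ> prod.swap" \<beta> \<alpha> \<gamma>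
    by (rule planar_swap)
  show ?thesis using s.x_axis[of "prod.swap p"] assms by (cases p) auto
qed

lemma edge_balanced:
  assumes "\<And>x. x \<in> D \<Longrightarrow> fst x - 1 \<le> \<tau> * snd x"
  shows "balanced_set J {x\<in>D. fst x - 1 = \<tau> * snd x} M f"
proof -
  have "balanced_set J {x\<in>D. fst x - \<tau> * snd x = 1} M f"
    using assms by (intro level_balanced) (auto simp: algebra_simps)
  moreover have "{x\<in>D. fst x - \<tau> * snd x = 1} = {x\<in>D. fst x - 1 = \<tau> * snd x}" by auto
  ultimately show ?thesis by simp
qed

text \<open>\<open>\<tau>\<close> is the inverse slope of the edge at \<open>(1,0)\<close> of the hull of \<open>D\<close> that does not run along the axis.\<close>
lemma second_edge:
  obtains \<tau> where "\<And>x. x \<in> D \<Longrightarrow> fst x - 1 \<le> \<tau> * snd x"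
    "(\<exists>x\<in>D. snd x > 0 \<and> fst x - 1 = \<tau> * snd x \<and> J (1,0) x \<noteq> 0 \<and> (1,0) + x \<in> M) \<or>
     (\<forall>x\<in>D. fst x - 1 = \<tau> * snd x \<longrightarrow> J (1,0) x = 0) \<and>
     (\<exists>x\<in>D. fst x - 1 = \<tau> * snd x \<and> x + x \<in> M \<and> J x x < 0)"
proof -
  let ?S = "{x\<in>D. snd x > 0}"
  have "(0,1) \<in> ?S" using corners(3) by simp
  then have "?S \<noteq> {}" by blast
  then obtain y where y: "y \<in> ?S" "\<And>x. x \<in> ?S \<Longrightarrow> - ((fst y - 1) / snd y) \<le> - ((fst x - 1) / snd x)"
    using finite_real_minimum[of ?S "\<lambda>x. - ((fst x - 1) / snd x)"] fin by auto
  define \<tau> where "\<tau> = (fst y - 1) / snd y"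
  have le: "fst x - 1 \<le> \<tau> * snd x" if "x \<in> D" for x
  proof (cases "snd x = 0")
    case True
    then show ?thesis using x_axis[OF that] by auto
  next
    case False
    then have p: "snd x > 0" using quadrant[OF that] by simp
    then have "(fst x - 1) / snd x \<le> \<tau>" using y(2)[of x] that by (simp add: \<tau>_def)
    then show ?thesis using p by (simp add: divide_le_eq)
  qed
  let ?T = "{x\<in>D. fst x - 1 = \<tau> * snd x}"
  interpret T: balanced_set J ?T M f by (rule edge_balanced[OF le])
  have yT: "y \<in> ?T" "snd y > 0" using y by (auto simp: \<tau>_def)
  have AT: "(1,0) \<in> ?T" using corners by simp
  have A0: "J (1,0) (1,0) = 0" by (simp add: Jf)
  show ?thesis
  proof (rule that[OF le])
    show "(\<exists>x\<in>D. snd x > 0 \<and> fst x - 1 = \<tau> * snd x \<and> J (1,0) x \<noteq> 0 \<and> (1,0) + x \<in> M) \<or>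
     (\<forall>x\<in>D. fst x - 1 = \<tau> * snd x \<longrightarrow> J (1,0) x = 0) \<and>
     (\<exists>x\<in>D. fst x - 1 = \<tau> * snd x \<and> x + x \<in> M \<and> J x x < 0)"
    \<comment> \<open>Either the edge has a neighbour of the null vertex \<open>(1,0)\<close>, or it
      is tangent to the null conic there. In the tangent case all its other points have negative
      \<open>J\<close>, which \<open>J_nonneg\<close> permits only if some point with negative
      \<open>J\<close> has its double in \<open>M\<close>.\<close>
    proof (cases "\<exists>x\<in>?T. J (1,0) x \<noteq> 0")
      case True
      then obtain x where x: "x \<in> ?T" "J (1,0) x \<noteq> 0" by blast
      have vert: "0 < snd (z - (1,0))" if "z \<in> ?T" "z \<noteq> (1,0)" for z
        using that quadrant[of z] by (cases z) force
      obtain z where z: "z \<in> ?T" "J (1,0) z \<noteq> 0" "(1,0) + z \<in> M"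
        by (rule T.null_vertex_neighbour[OF additive_positiveI[of snd] AT vert A0 x]) (simp, blast)
      then have "z \<noteq> (1,0)" using A0 by auto
      then show ?thesis using vert[OF z(1)] z by auto
    next
      case False
      then have yA: "J (1,0) y = 0" using yT by blast
      have "y \<noteq> (1,0)" using yT by auto
      then have "J y y < 0" using T.neg[OF yT(1) AT] A0 yA sym[of y "(1,0)"] by simp
      then have "\<exists>x\<in>?T. x + x \<in> M \<and> J x x < 0" using T.J_nonneg[OF _ yT(1)] by force
      then show ?thesis using False by blast
    qed
  qed
qed

text \<open>Points whose double is in \<open>M\<close> lie in the triangle, where
  \<open>J \<ge> 0\<close>, so the tangent alternative of \<open>second_edge\<close> fails. The
  other one needs a point of \<open>M\<close> with first coordinate at least 1 and positive second
  coordinate, and there is none.\<close>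

lemma no_opposite_targets:
  assumes PQ: "0 < P" "P < 1" "0 < Q" "Q < 1"
    and M: "M = {(1,0), (0,1), (P,Q), (1-P,1-Q)}"
  shows False
proof -
  have half: "J x x \<ge> 0" if x: "x \<in> D" "x + x \<in> M" for x
  proof (rule J_nonneg_triangle)
    show "0 \<le> fst x" "0 \<le> snd x" using quadrant x by auto
    have "2 * fst x + 2 * snd x < 2"
      using x(2) PQ unfolding M by (cases x) auto
    then show "fst x + snd x \<le> 1" by simp
  qed
  show False
  proof (rule second_edge)
    fix \<tau> :: real
    assume t: "(\<exists>x\<in>D. 0 < snd x \<and> fst x - 1 = \<tau> * snd x \<and> J (1, 0) x \<noteq> 0 \<and> (1, 0) + x \<in> M) \<or>
      (\<forall>x\<in>D. fst x - 1 = \<tau> * snd x \<longrightarrow> J (1, 0) x = 0) \<and>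
      (\<exists>x\<in>D. fst x - 1 = \<tau> * snd x \<and> x + x \<in> M \<and> J x x < 0)"
    have "\<not> (\<exists>x\<in>D. fst x - 1 = \<tau> * snd x \<and> x + x \<in> M \<and> J x x < 0)"
      using half by force
    then obtain x where "x \<in> D" "0 < snd x" "(1, 0) + x \<in> M" using t by blast
    then show False using quadrant[of x] PQ unfolding M by (cases x) auto
  qed
qed

end

text \<open>The corners \<open>v, s\<close> of the parallelogram are \<open>((1+P)/2, Q/2)\<close> and \<open>(P/2, (1+Q)/2)\<close>, and \<open>(P,Q)\<close> is
  the point \<open>e\<close> with \<open>v = (a + e)/2\<close> and \<open>s = (a' + e)/2\<close>.\<close>
locale planar_parallelogram = planar_set J D M f \<alpha> \<beta> \<gamma>
  for J :: "real \<times> real \<Rightarrow> real \<times> real \<Rightarrow> real" and D M f \<alpha> \<beta> \<gamma> +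
  fixes P Q :: real
  assumes PQ: "P > 0" "Q > 0"
    and M: "M = {(1,0), (0,1), (1+P,Q), (P,1+Q)}"
    and Msum: "\<xi> \<in> M \<Longrightarrow> \<exists>p\<in>D. \<exists>q\<in>D. p + q = \<xi>"
begin

section \<open>The support when \<open>u\<close> and \<open>w\<close> are adjacent corners\<close>

text \<open>The term pairing \<open>y\<close> with the origin is nonzero by
  \<open>J_origin_pos\<close>, so balance at \<open>y\<close> requires a decomposition avoiding the
  origin.\<close>

lemma origin_neighbour:
  assumes y: "y \<in> D" "y \<noteq> (0,0)" "(0,0) + y \<notin> M"
  obtains p q where "p \<in> D" "q \<in> D" "p + q = y" "p \<noteq> (0,0)" "q \<noteq> (0,0)"
proof -
  have "\<exists>p\<in>D. \<exists>q\<in>D. p + q = y \<and> p \<noteq> (0,0) \<and> q \<noteq> (0,0)"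
  proof (rule ccontr)
    assume n: "\<not> ?thesis"
    have "J (0,0) y = 0"
    proof (rule unique_pair_zero[OF corners(1) y(1,3)])
      fix p q assume pq: "p \<in> D" "q \<in> D" "p + q = (0,0) + y"
      then have "p + q = y" by (simp add: prod_eq_iff)
      then have "p = (0,0) \<or> q = (0,0)" using n pq by blast
      then show "p = (0,0) \<and> q = y \<or> p = y \<and> q = (0,0) \<or> J p q = 0"
        using \<open>p + q = y\<close> by (auto simp: prod_eq_iff)
    qed
    then show False using J_origin_pos y by fastforce
  qed
  then show ?thesis using that by blast
qed

text \<open>Otherwise the extra point of least coordinate sum would have sum at most 1 and split
  into two nonzero points of smaller sum. These must be among \<open>(1,0)\<close> and
  \<open>(0,1)\<close>, whose sums already add up to 2.\<close>

lemma parallelogram_sum_gt_1: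
  assumes "(P,Q) \<in> D"
  shows "P + Q > 1"
proof (rule ccontr)
  assume n: "\<not> P + Q > 1"
  let ?l = "\<lambda>x::real \<times> real. fst x + snd x"
  let ?S = "D - {(0,0),(1,0),(0,1)}"
  have pS: "(P,Q) \<in> ?S" using assms PQ by auto
  obtain y where y: "y \<in> ?S" "\<And>x. x \<in> ?S \<Longrightarrow> ?l y \<le> ?l x"
    using finite_real_minimum[of ?S ?l] fin pS by blast
  have ly: "?l y \<le> 1" using y(2)[OF pS] n by simp
  have "(0,0) + y \<notin> M" using y(1) ly PQ unfolding M by (cases y) auto
  moreover have "y \<in> D" "y \<noteq> (0,0)" using y(1) by auto
  ultimately obtain p q where pq: "p \<in> D" "q \<in> D" "p + q = y" "p \<noteq> (0,0)" "q \<noteq> (0,0)"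
    using origin_neighbour by blast
  have sum: "?l p + ?l q = ?l y" using pq(3) by auto
  have pos: "?l x > 0" if "x \<in> D" "x \<noteq> (0,0)" for x
    using quadrant[OF that(1)] that(2) by (cases x) auto
  have "p \<notin> ?S" "q \<notin> ?S" using y(2)[of p] y(2)[of q] sum pos pq by (smt (verit))+
  then have "?l p = 1" "?l q = 1" using pq by auto
  then show False using sum ly by simp
qed

text \<open>The edge at \<open>(1,0)\<close> is the line through \<open>v\<close> and
  \<open>(P,Q)\<close>. By \<open>second_edge\<close> it carries either \<open>(P,Q)\<close>, whose
  sum with \<open>(1,0)\<close> is in \<open>M\<close>, or \<open>v\<close>, whose double is in
  \<open>M\<close>; the rival points belonging to \<open>s\<close> are ruled out by the inequality
  that \<open>M\<close> inherits from the edge. Examining the far end \<open>m\<close> shows that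
  \<open>(P,Q)\<close> is null in the first case and that \<open>v\<close> is the end in the
  second.\<close>

lemma second_edge_cases:
  shows "x \<in> D \<Longrightarrow> Q * (fst x - 1) \<le> (P - 1) * snd x" (is "_ \<Longrightarrow> ?le x")
    and "P + Q > 1 \<and>
      ((P,Q) \<in> D \<and> J (P,Q) (P,Q) = 0 \<and> J (1,0) (P,Q) \<noteq> 0
       \<or> ((1+P)/2, Q/2) \<in> D \<and> J (1,0) ((1+P)/2, Q/2) = 0 \<and>
         (\<forall>x\<in>D. Q * (fst x - 1) = (P - 1) * snd x \<longrightarrow> snd x \<le> Q/2))" (is ?cases)
proof -
  obtain \<tau> where le: "\<And>x. x \<in> D \<Longrightarrow> fst x - 1 \<le> \<tau> * snd x"
    and t: "(\<exists>x\<in>D. snd x > 0 \<and> fst x - 1 = \<tau> * snd x \<and> J (1,0) x \<noteq> 0 \<and> (1,0) + x \<in> M) \<or>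
     (\<forall>x\<in>D. fst x - 1 = \<tau> * snd x \<longrightarrow> J (1,0) x = 0) \<and>
     (\<exists>x\<in>D. fst x - 1 = \<tau> * snd x \<and> x + x \<in> M \<and> J x x < 0)"
    by (rule second_edge) blast
  have leM: "fst \<xi> - 2 \<le> \<tau> * snd \<xi>" if "\<xi> \<in> M" for \<xi>
  proof -
    obtain p q where pq: "p \<in> D" "q \<in> D" "p + q = \<xi>" using Msum[OF \<open>\<xi> \<in> M\<close>] by blast
    then show ?thesis using le[OF pq(1)] le[OF pq(2)] by (auto simp: algebra_simps)
  qed
  have m1: "P - 1 \<le> \<tau> * Q" using leM[of "(1+P,Q)"] by (simp add: M)
  \<comment> \<open>The assumption puts the double of \<open>s\<close> on the doubled edge line;
    comparison with the double of \<open>v\<close> bounds \<open>P + Q\<close>.\<close>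
  have small: "P + Q \<le> 1" if "P - 2 = \<tau> * (1 + Q)"
  proof -
    have "(P - 1) * (1 + Q) \<le> \<tau> * Q * (1 + Q)" using m1 PQ by (intro mult_right_mono) auto
    also have "\<dots> = (P - 2) * Q" using that by (simp add: algebra_simps)
    finally show ?thesis by (simp add: algebra_simps)
  qed
  \<comment> \<open>Such an \<open>x\<close> would be \<open>(1/2,0)\<close> or
    \<open>(0,1/2)\<close>, which are not among the points of \<open>D\<close> on the axes.\<close>
  have half_on_axis: "x + x \<noteq> (1,0)" "x + x \<noteq> (0,1)" if "x \<in> D" for x
    using x_axis[OF that] y_axis[OF that] by (cases x; auto)+
  have main: "P - 1 = \<tau> * Q \<and> ((P,Q) \<in> D \<and> J (1,0) (P,Q) \<noteq> 0 \<or>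
      P + Q > 1 \<and> ((1+P)/2, Q/2) \<in> D \<and> (\<forall>x\<in>D. fst x - 1 = \<tau> * snd x \<longrightarrow> J (1,0) x = 0))"
    using t
  proof (elim disjE conjE bexE)
    fix x assume x: "x \<in> D" "snd x > 0" "fst x - 1 = \<tau> * snd x" "J (1,0) x \<noteq> 0" "(1,0) + x \<in> M"
    have "x \<noteq> (P - 1, 1 + Q)"
    proof
      assume e: "x = (P - 1, 1 + Q)"
      then have "P + Q \<le> 1" using x(3) by (intro small) simp
      then show False using e quadrant[OF x(1)] PQ by simp
    qed
    moreover have "x = (P,Q) \<or> x = (P - 1, 1 + Q)"
      using x(2,5) quadrant[OF x(1)] unfolding M by (cases x) auto
    ultimately show ?thesis using x by auto
  next
    fix x assume al: "\<forall>x\<in>D. fst x - 1 = \<tau> * snd x \<longrightarrow> J (1,0) x = 0"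
      and x: "x \<in> D" "fst x - 1 = \<tau> * snd x" "x + x \<in> M" "J x x < 0"
    have gt: "fst x + snd x > 1" using J_nonneg_triangle[of x] x(4) quadrant[OF x(1)] by fastforce
    have "x + x = (1+P,Q) \<or> x + x = (P,1+Q)" using x(3) half_on_axis[OF x(1)] unfolding M by blast
    then have c: "x = ((1+P)/2, Q/2) \<or> x = (P/2, (1+Q)/2)" by (cases x) auto
    have "x \<noteq> (P/2, (1+Q)/2)"
    proof
      assume e: "x = (P/2, (1+Q)/2)"
      then have "P - 2 = \<tau> * (1 + Q)" using x(2) by simp
      then show False using small gt e by (simp add: field_simps)
    qed
    then have e: "x = ((1+P)/2, Q/2)" using c by simp
    then have "P - 1 = \<tau> * Q" using x(2) by (simp add: field_simps)
    moreover have "P + Q > 1" using gt e by (simp add: field_simps)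
    ultimately show ?thesis using al x(1) e by simp
  qed
  then have \<tau>: "P - 1 = \<tau> * Q" by blast
  have iff: "Q * (fst x - 1) = (P - 1) * snd x \<longleftrightarrow> fst x - 1 = \<tau> * snd x" for x :: "real \<times> real"
    using PQ by (simp add: \<tau>)
  show "?le x" if "x \<in> D"
  proof -
    have "Q * (fst x - 1) \<le> Q * (\<tau> * snd x)" using le[OF that] PQ by simp
    then show ?thesis by (simp add: \<tau> mult_ac)
  qed
  have gt: "P + Q > 1" using main parallelogram_sum_gt_1 by blast
  have nt: "P - 2 \<noteq> \<tau> * (1 + Q)" using small gt by auto
  let ?T = "{x\<in>D. fst x - 1 = \<tau> * snd x}"
  interpret T: balanced_set J ?T M f by (rule edge_balanced[OF le])
  have AT: "(1,0) \<in> ?T" using corners by simp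
  have A0: "J (1,0) (1,0) = 0" by (simp add: Jf)
  obtain m where m: "m \<in> ?T" "\<And>x. x \<in> ?T \<Longrightarrow> snd x \<le> snd m"
    using finite_real_maximum[OF T.fin, of snd] AT by blast
  have vert: "0 < - snd (x - m)" if "x \<in> ?T" "x \<noteq> m" for x
  proof -
    have "snd x \<noteq> snd m" using that m(1) by (auto simp: prod_eq_iff)
    then show ?thesis using m(2)[OF that(1)] by simp
  qed
  have Pos: "additive_positive (\<lambda>x::real \<times> real. 0 < - snd x)"
    by (rule additive_positiveI[of "\<lambda>x. - snd x"]) simp
  have mm: "J m m = 0 \<or> m = ((1+P)/2, Q/2)"
  proof (cases "m + m \<in> M")
    case True
    have "m + m = (1+P,Q) \<or> m + m = (P,1+Q)" using True half_on_axis m(1) unfolding M by blast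
    moreover have "m + m \<noteq> (P,1+Q)"
    proof
      assume "m + m = (P,1+Q)"
      then have "m = (P/2, (1+Q)/2)" by (cases m) auto
      then show False using m(1) nt by (simp add: field_simps)
    qed
    ultimately show ?thesis by (cases m) auto
  next
    case False
    then show ?thesis using T.vertex_null_or_target[OF Pos m(1) vert] by blast
  qed
  consider (e) "(P,Q) \<in> D" "J (1,0) (P,Q) \<noteq> 0"
    | (v) "((1+P)/2, Q/2) \<in> D" "\<forall>x\<in>D. fst x - 1 = \<tau> * snd x \<longrightarrow> J (1,0) x = 0"
    using main by blast
  then show ?cases
  proof cases
    case v
    have vT: "((1+P)/2, Q/2) \<in> ?T" using v(1) \<tau> by (simp add: field_simps)
    \<comment> \<open>On a tangent edge every point except \<open>(1,0)\<close> has negative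
      \<open>J\<close>, so the far end is not null and must be \<open>v\<close>.\<close>
    have "m \<noteq> (1,0)" using m(2)[OF vT] PQ by auto
    then have "J m m \<noteq> 0" using T.neg[OF m(1) AT] A0 v(2) m(1) sym[of m "(1,0)"] by auto
    then have "m = ((1+P)/2, Q/2)" using mm by blast
    then have "\<forall>x\<in>D. Q * (fst x - 1) = (P - 1) * snd x \<longrightarrow> snd x \<le> Q/2"
      using m(2) iff by auto
    moreover have "J (1,0) ((1+P)/2, Q/2) = 0" using v vT by blast
    ultimately show ?thesis using gt v(1) by blast
  next
    case e
    have eT: "(P,Q) \<in> ?T" using e \<tau> by simp
    have lin: "J (1,0) z = snd z / Q * J (1,0) (P,Q)" if "z \<in> ?T" for z
    proof -
      have "fst z = 1 + \<tau> * snd z" using that by auto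
      moreover have "P = 1 + \<tau> * Q" using \<tau> by simp
      ultimately show ?thesis using PQ by (simp add: Jf field_simps)
    qed
    have mQ: "Q \<le> snd m" using m(2)[OF eT] by simp
    have "J (1,0) m \<noteq> 0" using lin[OF m(1)] e(2) mQ PQ by simp
    have m0: "J m m = 0" using mm mQ PQ by auto
    \<comment> \<open>Along the edge \<open>J m\<close> is affine, positive at \<open>(1,0)\<close>
      and zero at \<open>m\<close>, hence positive at a point \<open>(P,Q)\<close> strictly between.
      The neighbour \<open>y\<close> of \<open>m\<close> is then no lower than \<open>(P,Q)\<close>,
      so \<open>m + y\<close> lies on the doubled edge above height \<open>Q\<close>, where
      \<open>M\<close> has no point.\<close>
    have "m = (P,Q)"
    proof (rule ccontr)
      assume ne: "m \<noteq> (P,Q)"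
      have "J m (1,0) \<noteq> 0" using \<open>J (1,0) m \<noteq> 0\<close> sym[of m "(1,0)"] by simp
      then obtain y where y: "y \<in> ?T" "J m y \<noteq> 0" "m + y \<in> M"
          "\<And>z. z \<in> ?T \<Longrightarrow> 0 < - snd (y - z) \<Longrightarrow> J m z = 0"
        using T.null_vertex_neighbour[OF Pos m(1) vert m0 AT] by blast
      have "J m (P,Q) > 0"
      proof -
        define k where "k = J m (1 + \<tau>, 1) - J m (1,0)"
        have aff: "J m z = J m (1,0) + snd z * k" if "z \<in> ?T" for z
        proof -
          have "fst z = 1 + \<tau> * snd z" using that by auto
          then show ?thesis unfolding Jf k_def by (simp add: algebra_simps)
        qed
        have "m \<noteq> (1,0)" using mQ PQ by auto
        then have pos: "J m (1,0) > 0" using T.null_pair_pos[OF m(1) AT _ m0] A0 by simp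
        have "snd m * k < 0" using aff[OF m(1)] m0 pos by simp
        then have k: "k < 0" using mQ PQ by (simp add: mult_less_0_iff)
        have "Q < snd m" using vert[OF eT] ne by auto
        then have "snd m * k < Q * k" using k by simp
        then show ?thesis using aff[OF m(1)] aff[OF eT] m0 by simp
      qed
      then have "snd y \<ge> Q" using y(4)[OF eT] by force
      then have "snd (m + y) > Q" using mQ PQ by auto
      moreover have "fst (m + y) - 2 = \<tau> * snd (m + y)" using m(1) y(1) by (simp add: algebra_simps)
      ultimately show False using y(3) nt PQ gt \<tau> unfolding M by (cases "m + y") auto
    qed
    then show ?thesis using gt e m0 by blast
  qed
qed

lemma parallelogram_swap:
  "planar_parallelogram (\<lambda>p q. J (prod.swap p) (prod.swap q)) (prod.swap ` D) (prod.swap ` M)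
    (f \<circ> prod.swap) \<beta> \<alpha> \<gamma> Q P"
proof (intro planar_parallelogram.intro planar_swap planar_parallelogram_axioms.intro)
  show "prod.swap ` M = {(1,0), (0,1), (1+Q,P), (Q,1+P)}" unfolding M by auto
  fix \<xi> assume "\<xi> \<in> prod.swap ` M"
  then obtain \<zeta> where z: "\<zeta> \<in> M" "\<xi> = prod.swap \<zeta>" by blast
  obtain p q where pq: "p \<in> D" "q \<in> D" "p + q = \<zeta>" using Msum[OF z(1)] by blast
  have "prod.swap p + prod.swap q = \<xi>" using pq(3) z(2) by (auto simp: prod_eq_iff)
  then show "\<exists>p\<in>prod.swap ` D. \<exists>q\<in>prod.swap ` D. p + q = \<xi>" using pq by blast
qed (use PQ in auto)

lemma second_edge_cases':
  shows "x \<in> D \<Longrightarrow> P * (snd x - 1) \<le> (Q - 1) * fst x"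
    and "(P,Q) \<in> D \<and> J (P,Q) (P,Q) = 0 \<and> J (0,1) (P,Q) \<noteq> 0
       \<or> (P/2, (1+Q)/2) \<in> D \<and> J (0,1) (P/2, (1+Q)/2) = 0 \<and>
         (\<forall>x\<in>D. P * (snd x - 1) = (Q - 1) * fst x \<longrightarrow> fst x \<le> P/2)"
proof -
  interpret s: planar_parallelogram "\<lambda>p q. J (prod.swap p) (prod.swap q)" "prod.swap ` D" "prod.swap ` M"
    "f \<circ> prod.swap" \<beta> \<alpha> \<gamma> Q P by (rule parallelogram_swap)
  have mem: "(y, x) \<in> prod.swap ` D \<longleftrightarrow> (x, y) \<in> D" for x y by force
  show "x \<in> D \<Longrightarrow> P * (snd x - 1) \<le> (Q - 1) * fst x"
    using s.second_edge_cases(1)[of "prod.swap x"] by simp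
  show "(P,Q) \<in> D \<and> J (P,Q) (P,Q) = 0 \<and> J (0,1) (P,Q) \<noteq> 0
       \<or> (P/2, (1+Q)/2) \<in> D \<and> J (0,1) (P/2, (1+Q)/2) = 0 \<and>
         (\<forall>x\<in>D. P * (snd x - 1) = (Q - 1) * fst x \<longrightarrow> fst x \<le> P/2)"
    using s.second_edge_cases(2) by (simp add: mem)
qed

text \<open>The extra point of least coordinate sum can only be \<open>(1,1)\<close>, by the
  decomposition argument at the origin. So the extra point \<open>y\<close> of largest sum has sum
  at least 2, and \<open>(P,Q) + y\<close> has no other decomposition, giving
  \<open>J (P,Q) y = 0\<close>. With \<open>J y y \<ge> 0\<close> this contradicts negativity on
  differences.\<close>

lemma quadrilateral_case:
  assumes e: "(P,Q) \<in> D" "J (P,Q) (P,Q) = 0"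
  shows "D = {(0,0), (1,0), (0,1), (P,Q)}"
proof (rule ccontr)
  assume ne: "D \<noteq> {(0,0), (1,0), (0,1), (P,Q)}"
  let ?l = "\<lambda>x::real \<times> real. fst x + snd x"
  let ?I = "D - {(0,0), (1,0), (0,1), (P,Q)}"
  have I: "?I \<noteq> {}" "finite ?I" using ne e corners fin by auto
  have gt: "P + Q > 1" using second_edge_cases(2) by blast
  \<comment> \<open>The two edge inequalities add up to \<open>?l x \<le> P + Q\<close>; equality
    puts \<open>x\<close> on both edges, which meet only at \<open>(P,Q)\<close>.\<close>
  have lt_e: "?l x < P + Q" if "x \<in> D" "x \<noteq> (P,Q)" for x
  proof -
    have 1: "Q * (fst x - 1) \<le> (P - 1) * snd x" and 2: "P * (snd x - 1) \<le> (Q - 1) * fst x"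
      using second_edge_cases(1) second_edge_cases'(1) that by auto
    have le: "?l x \<le> P + Q" using 1 2 by (simp add: algebra_simps)
    moreover have "?l x \<noteq> P + Q"
    proof
      assume eq: "?l x = P + Q"
      then have "Q * (fst x - 1) = (P - 1) * snd x" using 1 2 by (simp add: algebra_simps)
      moreover have y: "snd x = P + Q - fst x" using eq by simp
      ultimately have "(fst x - P) * (P + Q - 1) = 0" by (simp add: algebra_simps)
      then have "fst x = P" using gt by simp
      then show False using that(2) y by (simp add: prod_eq_iff)
    qed
    ultimately show ?thesis by simp
  qed
  have pos: "?l x > 0" if "x \<in> D" "x \<noteq> (0,0)" for x
    using quadrant[OF that(1)] that(2) by (cases x) auto
  have one_one: "(1,1) \<in> ?I"
  proof -
    obtain y where y: "y \<in> ?I" "\<And>x. x \<in> ?I \<Longrightarrow> ?l y \<le> ?l x"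
      using finite_real_minimum[OF I(2,1), of ?l] by blast
    have yD: "y \<in> D" "y \<noteq> (0,0)" using y(1) by auto
    have y1: "Q * (fst y - 1) \<le> (P - 1) * snd y" and y2: "P * (snd y - 1) \<le> (Q - 1) * fst y"
      using second_edge_cases(1) second_edge_cases'(1) yD by auto
    have "y \<noteq> (1+P,Q)" "y \<noteq> (P,1+Q)" using y1 y2 PQ by (auto simp: algebra_simps)
    then have "(0,0) + y \<notin> M" using y(1) unfolding M by (cases y) auto
    then obtain p q where pq: "p \<in> D" "q \<in> D" "p + q = y" "p \<noteq> (0,0)" "q \<noteq> (0,0)"
      using origin_neighbour[OF yD] by blast
    have sum: "?l p + ?l q = ?l y" using pq(3) by auto
    have "p \<notin> ?I" "q \<notin> ?I" using y(2)[of p] y(2)[of q] sum pos pq by (smt (verit))+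
    then have "p \<in> {(1,0), (0,1), (P,Q)}" "q \<in> {(1,0), (0,1), (P,Q)}" using pq by auto
    moreover have "y \<noteq> (2,0)" "y \<noteq> (0,2)" using x_axis[OF yD(1)] y_axis[OF yD(1)] by auto
    moreover have "y \<noteq> (P+P,Q+Q)" using y1 PQ gt lt_e[OF yD(1)] y(1) by auto
    moreover have "y \<noteq> (1+P,Q)" "y \<noteq> (P,1+Q)" by fact+
    ultimately have "y = (1,1)" using pq(3) by (auto simp: add.commute)
    then show ?thesis using y(1) by simp
  qed
  obtain y where y: "y \<in> ?I" "\<And>x. x \<in> ?I \<Longrightarrow> ?l x \<le> ?l y"
    using finite_real_maximum[OF I(2,1), of ?l] by blast
  have l2: "?l y \<ge> 2" using y(2)[OF one_one] by simp
  have ye: "?l y < P + Q" using lt_e y(1) by auto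
  have "J (P,Q) y = 0"
  proof (rule unique_pair_zero[OF e(1)])
    show "y \<in> D" using y(1) by simp
    show "(P,Q) + y \<notin> M" using y(1) l2 ye PQ quadrant[of y] unfolding M by (cases y) auto
    fix p q assume pq: "p \<in> D" "q \<in> D" "p + q = (P,Q) + y"
    have sum: "?l p + ?l q = P + Q + ?l y" using pq(3) by (cases p; cases q; cases y) auto
    have "p = (P,Q) \<or> q = (P,Q)"
    proof (rule ccontr)
      assume n: "\<not> ?thesis"
      then have "?l p < P + Q" "?l q < P + Q" using lt_e pq by auto
      then have gt_y: "?l p > ?l y" "?l q > ?l y" using sum by linarith+
      then have "p \<notin> ?I" "q \<notin> ?I" using y(2)[of p] y(2)[of q] by linarith+
      then have "p \<in> {(0,0), (1,0), (0,1)}" using pq n by auto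
      then show False using gt_y(1) l2 by auto
    qed
    then show "p = (P,Q) \<and> q = y \<or> p = y \<and> q = (P,Q) \<or> J p q = 0"
      using pq(3) by (auto simp: add.commute)
  qed
  moreover have "J y y \<ge> 0"
  proof (rule J_nonneg)
    fix x assume x: "x \<in> D" "x + x \<in> M"
    have "x + x \<noteq> (1,0)" "x + x \<noteq> (0,1)" using x_axis[OF x(1)] y_axis[OF x(1)] by (cases x; auto)+
    \<comment> \<open>The remaining points of \<open>M\<close> are sums of \<open>(P,Q)\<close> with
      another null point \<open>z\<close> of \<open>D\<close>, so \<open>x\<close> is the midpoint
      of two null points with positive pairing.\<close>
    then have "x + x = (1,0) + (P,Q) \<or> x + x = (0,1) + (P,Q)" using x(2) unfolding M by auto
    then obtain z where z: "z \<in> {(1,0),(0,1)}" "x + x = z + (P,Q)" by blast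
    have zD: "z \<in> D" "z \<noteq> (P,Q)" "J z z = 0" using z(1) corners PQ by (auto simp: Jf)
    have "J x x + J x x = J x z + J x (P,Q)" using mid[OF z(2)] .
    moreover have "J z x + J z x = J z z + J z (P,Q)" using mid[OF z(2)] .
    moreover have "J (P,Q) x + J (P,Q) x = J (P,Q) z + J (P,Q) (P,Q)" using mid[OF z(2)] .
    moreover have "J z (P,Q) > 0" using null_pair_pos[OF zD(1) e(1) zD(2,3)] e(2) by simp
    ultimately show "J x x \<ge> 0" using zD(3) e(2) sym[of z x] sym[of "(P,Q)" x] sym[of "(P,Q)" z] by linarith
  qed (use y in auto)
  moreover have "y \<in> D" "(P,Q) \<noteq> y" using y(1) by auto
  then have "J (P,Q) (P,Q) + J y y < 2 * J (P,Q) y" by (rule neg[OF e(1)])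
  ultimately show False using e(2) by simp
qed

text \<open>No point of \<open>D\<close> lies beyond the line through \<open>v\<close> and
  \<open>s\<close>, so that line cuts out a face. In the parameter \<open>t\<close> with
  \<open>v\<close> at 0 and \<open>s\<close> at 1 the form is
  \<open>k * (t + t' - 2 * t * t') - j\<close>, and the result on the unit interval gives
  \<open>j = k\<close>, which is the vanishing of the form at \<open>(s, v)\<close>.\<close>

lemma tangent_case:
  assumes v: "((1+P)/2, Q/2) \<in> D" "J (1,0) ((1+P)/2, Q/2) = 0"
      "\<And>x. x \<in> D \<Longrightarrow> Q * (fst x - 1) = (P - 1) * snd x \<Longrightarrow> snd x \<le> Q/2"
    and s: "(P/2, (1+Q)/2) \<in> D" "J (0,1) (P/2, (1+Q)/2) = 0"
      "\<And>x. x \<in> D \<Longrightarrow> P * (snd x - 1) = (Q - 1) * fst x \<Longrightarrow> fst x \<le> P/2"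
  shows "J (P/2, (1+Q)/2) ((1+P)/2, Q/2) = 0"
proof -
  let ?l = "\<lambda>x::real \<times> real. fst x + snd x"
  define L where "L = (1 + P + Q) / 2"
  let ?v = "((1+P)/2, Q/2)" and ?s = "(P/2, (1+Q)/2)"
  have gt: "P + Q > 1" using second_edge_cases(2) by blast
  note le1 = second_edge_cases(1) and le2 = second_edge_cases'(1)
  have Ltop: "?l x \<le> L" if xD: "x \<in> D" for x
  proof (rule ccontr)
    assume "\<not> ?l x \<le> L"
    obtain m0 where m0: "m0 \<in> D" "\<And>y. y \<in> D \<Longrightarrow> ?l y \<le> ?l m0"
      using finite_real_maximum[OF fin, of ?l] xD by blast
    let ?F = "{y\<in>D. ?l y = ?l m0}"
    have "m0 \<in> ?F" using m0(1) by simp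
    then have "finite ?F" "?F \<noteq> {}" using fin by (simp, blast)
    then obtain m where m: "m \<in> ?F" "\<And>y. y \<in> ?F \<Longrightarrow> fst y \<le> fst m"
      using finite_real_maximum[of ?F fst] by blast
    have mL: "?l m > L" using m(1) m0(2)[OF xD] \<open>\<not> ?l x \<le> L\<close> by simp
    have mD: "m \<in> D" using m(1) by simp
    \<comment> \<open>The top level may contain several points; ties are broken by the first
      coordinate to make \<open>m\<close> a vertex.\<close>
    let ?Pos = "\<lambda>z::real \<times> real. ?l z < 0 \<or> ?l z = 0 \<and> fst z < 0"
    have Pos: "additive_positive ?Pos" by (auto simp: additive_positive_def)
    have vert: "?Pos (y - m)" if "y \<in> D" "y \<noteq> m" for y
    proof (cases "?l y = ?l m0")
      case True
      then have yF: "y \<in> ?F" using that by simp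
      have "fst y \<noteq> fst m" using True m(1) that(2) by (auto simp: prod_eq_iff)
      then have "fst y < fst m" using m(2)[OF yF] by simp
      then show ?thesis using True m(1) by simp
    next
      case False
      then show ?thesis using m0(2)[OF that(1)] m(1) by auto
    qed
    \<comment> \<open>If \<open>m + y\<close> were the double of \<open>v\<close>, both points would
      attain equality on the edge at \<open>(1,0)\<close>; the assumed end \<open>v\<close> of that
      edge then keeps \<open>m\<close> from lying beyond level \<open>L\<close>.\<close>
    have face1: "m + y \<noteq> (1+P,Q)" if y: "y \<in> D" for y
    proof
      assume eq: "m + y = (1+P,Q)"
      then have y': "fst y = 1 + P - fst m" "snd y = Q - snd m" by (cases m; cases y; auto)+
      have "Q * (1 + P - fst m - 1) \<le> (P - 1) * (Q - snd m)" using le1[OF y] by (simp only: y')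
      then have "Q * (fst m - 1) = (P - 1) * snd m"
        using le1[OF mD] by (simp add: algebra_simps)
      then have "snd m \<le> Q/2" "Q * (fst m + snd m - 1) = (P + Q - 1) * snd m"
        using v(3)[OF mD] by (simp_all add: algebra_simps)
      then have "Q * (fst m + snd m - 1) \<le> Q * ((P + Q - 1) / 2)"
        using gt mult_left_mono[of "snd m" "Q/2" "P + Q - 1"] by (simp add: mult_ac)
      then have "fst m + snd m - 1 \<le> (P + Q - 1) / 2" using PQ by simp
      then show False using mL by (simp add: L_def field_simps)
    qed
    have face2: "m + y \<noteq> (P,1+Q)" if y: "y \<in> D" for y
    proof
      assume eq: "m + y = (P,1+Q)"
      then have y': "snd y = 1 + Q - snd m" "fst y = P - fst m" by (cases m; cases y; auto)+
      have "P * (1 + Q - snd m - 1) \<le> (Q - 1) * (P - fst m)" using le2[OF y] by (simp only: y')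
      then have "P * (snd m - 1) = (Q - 1) * fst m"
        using le2[OF mD] by (simp add: algebra_simps)
      then have "fst m \<le> P/2" "P * (fst m + snd m - 1) = (P + Q - 1) * fst m"
        using s(3)[OF mD] by (simp_all add: algebra_simps)
      then have "P * (fst m + snd m - 1) \<le> P * ((P + Q - 1) / 2)"
        using gt mult_left_mono[of "fst m" "P/2" "P + Q - 1"] by (simp add: mult_ac)
      then have "fst m + snd m - 1 \<le> (P + Q - 1) / 2" using PQ by simp
      then show False using mL by (simp add: L_def field_simps)
    qed
    have notM: "m + y \<notin> M" if y: "y \<in> D" for y
    proof -
      have "?l (m + y) > 1" using mL gt quadrant[OF y] by (simp add: L_def field_simps)
      then have "m + y \<noteq> (1,0)" "m + y \<noteq> (0,1)" by (metis fst_conv snd_conv add.right_neutral add.left_neutral less_irrefl)+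
      then show ?thesis using face1[OF y] face2[OF y] unfolding M by blast
    qed
    have mm: "J m m = 0" using vertex_null_or_target[OF Pos mD vert notM[OF mD]] by blast
    have "m \<noteq> (0,0)" using mL gt by (auto simp: L_def)
    then have "J m (0,0) \<noteq> 0" using J_origin_pos[OF mD] sym[of m "(0,0)"] by simp
    then obtain y where "y \<in> D" "m + y \<in> M"
      using null_vertex_neighbour[OF Pos mD vert mm corners(1)] by blast
    then show False using notM by blast
  qed
  let ?S = "{x\<in>D. ?l x = L}"
  interpret S: balanced_set J ?S M f using Ltop by (intro level_balanced) auto
  define j where "j = - J ?v ?v"
  \<comment> \<open>As \<open>s - v\<close> is half of \<open>(0,1) - (1,0)\<close>, the form on it
    is \<open>- \<gamma> / 2\<close>, which is \<open>- 2 * k\<close>. The two tangency equations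
    make the form take the same value at \<open>v\<close> and at \<open>s\<close>.\<close>
  define k where "k = \<gamma> / 4"
  have e1: "\<alpha> * (P + Q - 1) = \<gamma> * Q" and e2: "\<beta> * (P + Q - 1) = \<gamma> * P"
    using v(2) s(2) by (simp_all add: Jf field_simps)
  define pt where "pt t = ((1+P)/2 - t/2, Q/2 + t/2)" for t :: real
  have Jpt: "J (pt t) (pt t') = k * (t + t' - 2 * t * t') - j" for t t'
  proof -
    \<comment> \<open>Tangency expresses \<open>\<alpha>\<close> and \<open>\<beta>\<close> as
      multiples of \<open>\<gamma> / g\<close>; multiplying by \<open>g > 0\<close> clears the
      denominator.\<close>
    define g where "g = P + Q - 1"
    have P: "P = g + 1 - Q" by (simp add: g_def)
    have eg: "\<alpha> * g = \<gamma> * Q" "\<beta> * g = \<gamma> * P" using e1 e2 by (simp_all add: g_def)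
    have scaled: "g * J p q = \<gamma> * (Q * ((1 - fst p - snd p) * fst q + fst p * (1 - fst q - snd q))
        + P * ((1 - fst p - snd p) * snd q + snd p * (1 - fst q - snd q))
        + g * (fst p * snd q + snd p * fst q))" (is "_ = \<gamma> * (Q * ?A + P * ?B + g * ?C)") for p q
    proof -
      have "g * J p q = (\<alpha> * g) * ?A + (\<beta> * g) * ?B + \<gamma> * g * ?C" unfolding Jf by algebra
      then show ?thesis by (simp only: eg distrib_left mult.assoc)
    qed
    have "g * (J (pt t) (pt t') + j) = g * (k * (t + t' - 2 * t * t'))"
      unfolding j_def distrib_left minus_mult_right[symmetric] scaled pt_def k_def P
      by (simp add: field_simps)
    then show ?thesis using gt by (simp add: g_def)
  qed
  have on_edge: "x = pt (2 * snd x - Q) \<and> 0 \<le> 2 * snd x - Q \<and> 2 * snd x - Q \<le> 1" if x: "x \<in> ?S" for x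
  proof -
    have f: "fst x = L - snd x" and xD: "x \<in> D" using x by auto
    have "Q * ((P + Q - 1) / 2) \<le> snd x * (P + Q - 1)"
      using le1[OF xD] unfolding f L_def by (simp add: field_simps)
    then have "(Q / 2) * (P + Q - 1) \<le> snd x * (P + Q - 1)" by (simp add: mult_ac)
    then have 1: "Q / 2 \<le> snd x" using gt by simp
    have "snd x * (P + Q - 1) \<le> ((1 + Q) / 2) * (P + Q - 1)"
      using le2[OF xD] unfolding f L_def by (simp add: field_simps)
    then have "snd x \<le> (1 + Q) / 2" using gt by simp
    moreover have "x = pt (2 * snd x - Q)" using f by (simp add: prod_eq_iff pt_def L_def field_simps)
    ultimately show ?thesis using 1 by simp
  qed
  let ?R = "{t. pt t \<in> ?S}"
  have inj: "inj pt" by (auto simp: inj_def pt_def)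
  have pt01: "pt 0 = ?v" "pt 1 = ?s" by (simp_all add: pt_def field_simps)
  have "?l ?v = L" "?l ?s = L" by (simp_all add: L_def field_simps)
  then have vS: "0 \<in> ?R" "1 \<in> ?R" using v(1) s(1) by (simp_all add: pt01)
  have "j = k"
  proof (rule balanced_unit_interval[OF _ _ vS])
    \<comment> \<open>This parametrises the doubled edge by totals, with the doubles of
      \<open>v\<close> and \<open>s\<close> at 0 and 2; these are its only points in
      \<open>M\<close>.\<close>
    let ?s = "\<lambda>\<xi>. (1 + P - \<xi> / 2, Q + \<xi> / 2)"
    have "balanced_set (\<lambda>s t. J (pt s) (pt t)) (pt -` ?S) (?s -` M) (f \<circ> pt)"
    proof (rule S.vimage_balanced[OF inj])
      show "?S \<subseteq> range pt" using on_edge by blast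
      show "pt p + pt q = ?s (p + q)" for p q by (simp add: pt_def add_divide_distrib)
    qed (auto simp: inj_def)
    moreover have "?s -` M = {0, 2}" using PQ unfolding M by auto
    moreover have "pt -` ?S = ?R" by auto
    ultimately show "balanced_set (\<lambda>s t. k * (s + t - 2 * s * t) - j) ?R {0, 2} (f \<circ> pt)"
      by (simp add: Jpt)
    show "?R \<subseteq> {0..1}"
    proof
      fix t assume "t \<in> ?R"
      then have "0 \<le> 2 * snd (pt t) - Q \<and> 2 * snd (pt t) - Q \<le> 1" using on_edge by blast
      then show "t \<in> {0..1}" by (simp add: pt_def)
    qed
    show "j > 0"
    proof -
      have "?v \<noteq> (1,0)" using PQ by simp
      then have "J ?v ?v + J (1,0) (1,0) < 2 * J ?v (1,0)" using neg[OF v(1) corners(2)] by blast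
      then show ?thesis using v(2) sym[of ?v "(1,0)"] by (simp add: j_def Jf)
    qed
    show "k > 0" using coefficients_pos by (simp add: k_def)
  qed
  then show ?thesis by (simp add: pt01[symmetric] Jpt)
qed

lemma parallelogram_dichotomy:
  shows "J (P,Q) (P,Q) = 0 \<and> D = {(0,0), (1,0), (0,1), (P,Q)} \<or>
    ((1+P)/2, Q/2) \<in> D \<and> (P/2, (1+Q)/2) \<in> D \<and> J (1,0) ((1+P)/2, Q/2) = 0 \<and>
    J (0,1) (P/2, (1+Q)/2) = 0 \<and> J (P/2, (1+Q)/2) ((1+P)/2, Q/2) = 0"
proof (cases "(P,Q) \<in> D \<and> J (P,Q) (P,Q) = 0")
  case True
  then show ?thesis using quadrilateral_case by blast
next
  case False
  then show ?thesis using second_edge_cases(2) second_edge_cases'(2) tangent_case by blast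
qed

text \<open>All pairings are positive, so negative sums along the four sides give adjacent weights
  opposite signs and opposite weights equal signs. The total \<open>(P,Q)\<close> is outside
  \<open>M\<close>, yet its sum consists of one diagonal, or of both if
  \<open>(P,Q) = (1,1)\<close>, and cannot vanish.\<close>

lemma quadrilateral_not_all_negative:
  assumes D: "D = {(0,0), (1,0), (0,1), (P,Q)}" and e: "J (P,Q) (P,Q) = 0"
    and neg_M: "\<And>\<zeta>. \<zeta> \<in> M \<Longrightarrow> pair_sum J f D \<zeta> < 0"
  shows False
proof -
  let ?e = "(P,Q)"
  have pair: "J x y > 0" if "x \<in> D" "y \<in> D" "x \<noteq> y" for x y
  proof (rule null_pair_pos[OF that])
    show "J x x = 0" "J y y \<ge> 0" using that(1,2) e unfolding D by (auto simp: Jf)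
  qed
  have two: "pair_sum J f D (x + y) = 2 * J x y * f x * f y"
    if "x \<in> D" "y \<in> D" "x \<noteq> y" "{p \<in> D \<times> D. fst p + snd p = x + y} = {(x,y), (y,x)}" for x y
    unfolding pair_sum_def that(4) using that(3) sym[of y x] by simp
  have sgn: "f x * f y < 0" if "x \<in> D" "y \<in> D" "x \<noteq> y" "x + y \<in> M"
    "{p \<in> D \<times> D. fst p + snd p = x + y} = {(x,y), (y,x)}" for x y
  proof -
    have "2 * J x y * f x * f y < 0" using neg_M[OF that(4)] two[OF that(1-3,5)] by simp
    then show ?thesis using pair[OF that(1-3)] by (simp add: mult.assoc mult_less_0_iff zero_less_mult_iff)
  qed
  have 1: "f (0,0) * f (1,0) < 0"
    by (rule sgn) (use PQ in \<open>auto simp: D M\<close>)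
  have 2: "f (0,0) * f (0,1) < 0"
    by (rule sgn) (use PQ in \<open>auto simp: D M\<close>)
  have 3: "f (1,0) * f ?e < 0"
    by (rule sgn) (use PQ in \<open>auto simp: D M\<close>)
  have oe: "J (0,0) ?e > 0" and aa: "J (1,0) (0,1) > 0"
    using pair PQ by (auto simp: D)
  have nM: "?e \<notin> M" using PQ by (auto simp: M)
  show False
  proof (cases "?e = (1,1)")
    case False
    have "J (0,0) ?e = 0"
    proof (rule unique_pair_zero)
      show "(0,0) + ?e \<notin> M" using nM by simp
      fix p q assume "p \<in> D" "q \<in> D" "p + q = (0,0) + ?e"
      then show "p = (0,0) \<and> q = ?e \<or> p = ?e \<and> q = (0,0) \<or> J p q = 0"
        using PQ False by (auto simp: D)
    qed (auto simp: D)
    then show False using oe by simp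
  next
    case True
    have "{p \<in> D \<times> D. fst p + snd p = ?e} = {((0,0),?e), (?e,(0,0)), ((1,0),(0,1)), ((0,1),(1,0))}"
      using True by (auto simp: D)
    then have "pair_sum J f D ?e = 2 * J (0,0) ?e * (f (0,0) * f ?e) + 2 * J (1,0) (0,1) * (f (1,0) * f (0,1))"
      unfolding pair_sum_def using True sym[of ?e "(0,0)"] sym[of "(0,1)" "(1,0)"] by simp
    moreover have "f (0,0) * f ?e > 0" "f (1,0) * f (0,1) > 0"
      using 1 2 3 by (auto simp: mult_less_0_iff zero_less_mult_iff)
    ultimately have "pair_sum J f D ?e > 0" using oe aa by (simp add: add_pos_pos)
    then show False using bal[OF nM] by simp
  qed
qed

end

section \<open>The cone at a null vertex\<close>

lemma extreme_point_strict_support: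
  fixes D :: "'v::euclidean_space set"
  assumes "finite D" "c extreme_point_of (convex hull D)"
  obtains l where "\<And>x. x \<in> D \<Longrightarrow> x \<noteq> c \<Longrightarrow> 0 < l \<bullet> (x - c)"
proof -
  have "convex (convex hull D - {c})" using assms(2) extreme_point_of_stillconvex by blast
  moreover have "D - {c} \<subseteq> convex hull D - {c}" using hull_subset[of D convex] by auto
  ultimately have "convex hull (D - {c}) \<subseteq> convex hull D - {c}" by (simp add: hull_minimal)
  then have "c \<notin> convex hull (D - {c})" by blast
  moreover have "closed (convex hull (D - {c}))"
    using assms(1) by (simp add: compact_imp_closed finite_imp_compact_convex_hull)
  ultimately obtain l b where l: "l \<bullet> c < b" "\<And>x. x \<in> convex hull (D - {c}) \<Longrightarrow> b < l \<bullet> x"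
    using separating_hyperplane_closed_point[OF convex_convex_hull] by blast
  show ?thesis
  proof (rule that)
    fix x assume "x \<in> D" "x \<noteq> c"
    then have "x \<in> convex hull (D - {c})" by (simp add: hull_inc)
    then show "0 < l \<bullet> (x - c)" using l by (force simp: inner_diff_right)
  qed
qed

text \<open>Were \<open>x - c\<close> outside the closed cone over \<open>K\<close>, a functional
  \<open>\<phi>\<close> nonnegative on the cone would be negative at it. Tilting
  \<open>\<phi>\<close> by a strict support \<open>l\<close> of the vertex gives a face of
  \<open>D\<close> through \<open>c\<close> and another point, no two of whose points sum into
  \<open>M\<close>. On this face \<open>J_nonneg\<close> makes \<open>c\<close> pair positively with
  that point, and \<open>null_vertex_neighbour\<close> then produces a sum in
  \<open>M\<close>.\<close>

lemma null_vertex_cone: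
  fixes J :: "'v::euclidean_space \<Rightarrow> 'v \<Rightarrow> real"
  assumes bs: "balanced_set J D M f"
    and Msum: "\<And>\<xi>. \<xi> \<in> M \<Longrightarrow> \<exists>p\<in>D. \<exists>q\<in>D. p + q = \<xi>"
    and MK: "\<And>\<xi>. \<xi> \<in> M \<Longrightarrow> (1/2) *\<^sub>R \<xi> \<in> K"
    and K: "compact K" "convex K" "K \<noteq> {}" "c \<notin> K"
    and c: "c \<in> D" "J c c = 0" "c extreme_point_of (convex hull D)"
    and x: "x \<in> D"
  obtains t k where "t \<ge> 0" "k \<in> K" "x - c = t *\<^sub>R (k - c)"
proof -
  interpret balanced_set J D M f by fact
  let ?K0 = "(\<lambda>k. k - c) ` K"
  let ?Z = "conic hull ?K0"
  have "compact ?K0" "0 \<notin> ?K0"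
    using K by (auto intro!: compact_continuous_image continuous_intros)
  then have Z: "closed ?Z" by (intro closed_conic_hull) simp
  have "convex ?K0" using K(2) convex_translation_subtract_eq by auto
  then have Zc: "convex ?Z" by (rule convex_conic_hull)
  have Zmem: "z \<in> ?Z \<longleftrightarrow> (\<exists>t k. 0 \<le> t \<and> k \<in> K \<and> z = t *\<^sub>R (k - c))" for z
    unfolding conic_hull_explicit by blast
  obtain k0 where k0: "k0 \<in> K" using K(3) by blast
  have Z0: "0 \<in> ?Z" unfolding Zmem using k0 by (intro exI[of _ 0] exI[of _ k0]) simp
  have "x - c \<in> ?Z"
  proof (rule ccontr)
    assume xZ: "x - c \<notin> ?Z"
    then have xc: "x \<noteq> c" using Z0 by auto
    obtain \<phi> b where \<phi>: "\<phi> \<bullet> (x - c) < b" "\<And>z. z \<in> ?Z \<Longrightarrow> b < \<phi> \<bullet> z"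
      using separating_hyperplane_closed_point[OF Zc Z xZ] by blast
    have b: "b < 0" using \<phi>(2)[OF Z0] by simp
    have \<phi>K: "\<phi> \<bullet> (k - c) \<ge> 0" if "k \<in> K" for k
    proof (rule ccontr)
      assume n: "\<not> ?thesis"
      \<comment> \<open>A functional bounded below on a cone is nonnegative there; at this multiple
        its value would be exactly the excluded bound \<open>b\<close>.\<close>
      define t where "t = b / (\<phi> \<bullet> (k - c))"
      have "t \<ge> 0" using n b by (simp add: t_def divide_nonpos_nonpos)
      then have "b < \<phi> \<bullet> (t *\<^sub>R (k - c))" using \<phi>(2) Zmem that by blast
      then show False using n by (simp add: t_def)
    qed
    obtain l where l: "\<And>x. x \<in> D \<Longrightarrow> x \<noteq> c \<Longrightarrow> 0 < l \<bullet> (x - c)"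
      using extreme_point_strict_support[OF fin c(3)] by blast
    have "finite (D - {c})" "D - {c} \<noteq> {}" using fin x xc by auto
    then obtain y0 where y0: "y0 \<in> D - {c}"
      "\<And>y. y \<in> D - {c} \<Longrightarrow> (\<phi> \<bullet> (y0 - c)) / (l \<bullet> (y0 - c)) \<le> (\<phi> \<bullet> (y - c)) / (l \<bullet> (y - c))"
      using finite_real_minimum[of "D - {c}" "\<lambda>y. (\<phi> \<bullet> (y - c)) / (l \<bullet> (y - c))"] by blast
    define \<tau> where "\<tau> = (\<phi> \<bullet> (y0 - c)) / (l \<bullet> (y0 - c))"
    have \<tau>le: "\<tau> * (l \<bullet> (y - c)) \<le> \<phi> \<bullet> (y - c)" if "y \<in> D" for y
    proof (cases "y = c")
      case False
      then have "\<tau> \<le> (\<phi> \<bullet> (y - c)) / (l \<bullet> (y - c))" using y0(2) that by (simp add: \<tau>_def)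
      then show ?thesis using l[OF that False] by (simp add: le_divide_eq)
    qed simp
    have "\<tau> * (l \<bullet> (x - c)) < 0" using \<tau>le[OF x] \<phi>(1) b by linarith
    then have \<tau>neg: "\<tau> < 0" using l[OF x xc] by (simp add: mult_less_0_iff)
    \<comment> \<open>Since \<open>\<tau>\<close> is the least ratio of \<open>\<phi>\<close> to
      \<open>l\<close>, the maximum of \<open>\<psi>\<close> on \<open>D\<close> is attained at both
      \<open>c\<close> and \<open>y0\<close>; since \<open>\<tau> < 0\<close>, the doubled maximum
      is not reached on \<open>M\<close>.\<close>
    define \<psi> where "\<psi> = \<tau> *\<^sub>R l - \<phi>"
    have \<psi>D: "\<psi> \<bullet> y \<le> \<psi> \<bullet> c" if "y \<in> D" for y
      using \<tau>le[OF that] by (simp add: \<psi>_def inner_diff inner_diff_right algebra_simps)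
    have \<psi>M: "\<psi> \<bullet> \<xi> < 2 * (\<psi> \<bullet> c)" if \<xi>: "\<xi> \<in> M" for \<xi>
    proof -
      obtain p q where pq: "p \<in> D" "q \<in> D" "p + q = \<xi>" using Msum[OF \<xi>] by blast
      have "p \<noteq> c \<or> q \<noteq> c" using MK[OF \<xi>] K(4) pq(3) by (auto simp: scaleR_2[symmetric])
      then have "l \<bullet> (p - c) + l \<bullet> (q - c) > 0"
        using l[OF pq(1)] l[OF pq(2)] by (cases "p = c"; cases "q = c") auto
      then have "\<tau> * (l \<bullet> (p - c) + l \<bullet> (q - c)) < 0" using \<tau>neg by (simp add: mult_less_0_iff)
      then have 1: "\<tau> * (l \<bullet> \<xi>) < 2 * \<tau> * (l \<bullet> c)"
        unfolding pq(3)[symmetric] by (simp add: inner_diff_right inner_add_right algebra_simps)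
      have "0 \<le> \<phi> \<bullet> \<xi> - 2 * (\<phi> \<bullet> c)" using \<phi>K[OF MK[OF \<xi>]] by (simp add: inner_diff_right)
      then show ?thesis using 1 by (simp add: \<psi>_def inner_diff_left)
    qed
    let ?T = "{y\<in>D. \<psi> \<bullet> y = \<psi> \<bullet> c}"
    interpret T: balanced_set J ?T M f
      using \<psi>D by (intro level_balanced) (auto simp: inner_add_right)
    have cT: "c \<in> ?T" using c by simp
    have y0T: "y0 \<in> ?T"
    proof -
      have "l \<bullet> (y0 - c) > 0" using l y0(1) by auto
      then have "\<tau> * (l \<bullet> (y0 - c)) = \<phi> \<bullet> (y0 - c)" by (simp add: \<tau>_def)
      then show ?thesis using y0(1) by (simp add: \<psi>_def inner_diff_left inner_diff_right algebra_simps)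
    qed
    have nM: "p + q \<notin> M" if "p \<in> ?T" "q \<in> ?T" for p q
      using \<psi>M[of "p + q"] that by (auto simp: inner_add_right)
    have "J y0 y0 \<ge> 0" using T.J_nonneg[OF _ y0T] nM by blast
    then have "J c y0 > 0" using null_pair_pos[OF c(1) _ _ c(2)] y0(1) by auto
    then have "J c y0 \<noteq> 0" by simp
    have Pos: "additive_positive (\<lambda>z. 0 < l \<bullet> z)" by (intro additive_positiveI) (simp add: inner_add_right)
    have vert: "0 < l \<bullet> (z - c)" if "z \<in> ?T" "z \<noteq> c" for z using l that by blast
    obtain y where "y \<in> ?T" "c + y \<in> M"
      using T.null_vertex_neighbour[OF Pos cT vert c(2) y0T \<open>J c y0 \<noteq> 0\<close>] by blast
    then show False using nM cT by blast
  qed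
  then show ?thesis using that Zmem by blast
qed

section \<open>Parallelograms\<close>

lemma convex_hull_face_of_functional:
  fixes g :: "'a::euclidean_space \<Rightarrow> real"
  assumes "finite S" "T \<subseteq> S" "linear g"
    and eq: "\<And>x. x \<in> T \<Longrightarrow> g x = k" and gt: "\<And>x. x \<in> S - T \<Longrightarrow> g x > k"
  shows "convex hull T face_of convex hull S"
proof (rule face_of_convex_hulls[OF assms(1,2)])
  interpret linear g by fact
  have "affine {x. g x = k}"
    by (auto simp: affine_def add scaleR distrib_right[symmetric])
  then have "affine hull T \<subseteq> {x. g x = k}" using eq by (intro hull_minimal) auto
  moreover have "convex {x. g x > k}"
    using convex_linear_vimage[OF assms(3), of "{k<..}"] by (simp add: vimage_def)
  then have "convex hull (S - T) \<subseteq> {x. g x > k}" using gt by (intro hull_minimal) auto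
  ultimately show "affine hull T \<inter> convex hull (S - T) = {}" by force
qed

text \<open>The functionals \<open>g\<close> and \<open>h\<close> dual to the edge vectors at
  \<open>p\<close> serve as coordinates: \<open>g + h\<close> is least only at \<open>p\<close>, and
  \<open>h\<close> only on the side \<open>p q\<close>. The diagonal \<open>p r\<close> contains the
  midpoint of \<open>q\<close> and \<open>s\<close> but not \<open>q\<close>, so it is no
  face.\<close>

lemma parallelogram_vertex:
  fixes p q r s :: "'a::euclidean_space"
  assumes G: "G = convex hull {p, q, r, s}" and sum: "p + r = q + s" and dim: "aff_dim G = 2"
  shows "p extreme_point_of G" and "distinct [p, q, r, s]"
    and "convex hull {p, q} face_of G" and "\<not> convex hull {p, r} face_of G"
proof -
  have r: "r = q + s - p" using sum by (simp add: algebra_simps)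
  have rin: "r \<in> affine hull {p, q, s}"
  proof -
    have "r = (-1) *\<^sub>R p + 1 *\<^sub>R q + 1 *\<^sub>R s" using r by simp
    then show ?thesis unfolding affine_hull_3 by (intro CollectI exI[of _ "-1"] exI[of _ 1] conjI) auto
  qed
  have "aff_dim {p, q, s} = 2"
  proof -
    have "insert r {p, q, s} = {p, q, r, s}" by auto
    then have "aff_dim (insert r {p, q, s}) = 2" using dim G by (simp add: aff_dim_convex_hull)
    then show ?thesis using rin by (simp add: aff_dim_insert)
  qed
  moreover have "aff_dim {p, q, s} \<le> int (card {p, q, s}) - 1" by (intro aff_dim_le_card) simp
  moreover have "card {p, q, s} \<le> 3" by (simp add: card_insert_if)
  ultimately have card: "card {p, q, s} = 3" by linarith
  have dist: "p \<noteq> q" "p \<noteq> s" "q \<noteq> s" using card by (auto simp: card_insert_if split: if_splits)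
  have "\<not> affine_dependent {p, q, s}"
    using affine_independent_iff_card[of "{p, q, s}"] \<open>aff_dim {p, q, s} = 2\<close> card by simp
  then have "independent ((\<lambda>x. x - p) ` {q, s})"
    using affine_dependent_iff_dependent[of p "{q, s}"] dist by (simp add: insert_commute)
  then have ind: "independent {q - p, s - p}" by simp
  have ne: "q - p \<noteq> s - p" using dist by simp
  obtain g where g: "linear g" "\<And>x. x \<in> {q - p, s - p} \<Longrightarrow> g x = (if x = q - p then 1 else (0::real))"
    using linear_independent_extend[OF ind, of "\<lambda>x. if x = q - p then 1 else (0::real)"] by blast
  obtain h where h: "linear h" "\<And>x. x \<in> {q - p, s - p} \<Longrightarrow> h x = (if x = s - p then 1 else (0::real))"
    using linear_independent_extend[OF ind, of "\<lambda>x. if x = s - p then 1 else (0::real)"] by blast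
  interpret g: linear g by fact
  interpret h: linear h by fact
  have gv: "g q = g p + 1" "g s = g p" "g r = g p + 1"
    using g(2)[of "q - p"] g(2)[of "s - p"] ne r by (auto simp: g.diff g.add)
  have hv: "h q = h p" "h s = h p + 1" "h r = h p + 1"
    using h(2)[of "q - p"] h(2)[of "s - p"] ne r by (auto simp: h.diff h.add)
  show "distinct [p, q, r, s]" using gv hv by auto
  have "convex hull {p} face_of convex hull {p, q, r, s}"
    by (rule convex_hull_face_of_functional[where g = "\<lambda>x. g x + h x" and k = "g p + h p"])
      (use gv hv in \<open>auto intro: linear_compose_add g h\<close>)
  then show "p extreme_point_of G" using G by (simp add: face_of_singleton)
  show "convex hull {p, q} face_of G" unfolding G
    by (rule convex_hull_face_of_functional[where g = h and k = "h p"]) (use gv hv h in auto)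
  show "\<not> convex hull {p, r} face_of G"
  proof
    assume face: "convex hull {p, r} face_of G"
    have m: "midpoint q s \<in> convex hull {p, r}"
      using midpoint_in_closed_segment[of p r] sum by (simp add: segment_convex_hull midpoint_def)
    have "midpoint q s \<in> open_segment q s" using dist by simp
    moreover have "q \<in> G" "s \<in> G" unfolding G by (simp_all add: hull_inc)
    ultimately have "q \<in> convex hull {p, r}" using face m unfolding face_of_def by blast
    moreover have "convex hull {p, r} \<subseteq> {x. g x - h x = g p - h p}"
    proof (rule hull_minimal)
      have "{x. g x - h x = g p - h p} = (\<lambda>x. g x - h x) -` {g p - h p}" by auto
      then show "convex {x. g x - h x = g p - h p}"
        using convex_linear_vimage[OF linear_compose_sub[OF g(1) h(1)], of "{g p - h p}"] by simp
    qed (use gv hv in auto)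
    ultimately show False using gv hv by auto
  qed
qed

lemma parallelogram_adjacent:
  fixes p q r s :: "'a::euclidean_space"
  assumes G: "G = convex hull {p, q, r, s}" and sum: "p + r = q + s" and dim: "aff_dim G = 2"
  shows "{x. x extreme_point_of G} = {p, q, r, s}"
    and "adjacent_vertices G p x \<longleftrightarrow> x = q \<or> x = s"
proof -
  \<comment> \<open>Three rotations supply the other vertices and sides, and the reflection fixing
    \<open>p\<close> supplies the second side at \<open>p\<close>.\<close>
  have rot: "{q, r, s, p} = {p, q, r, s}" "{r, s, p, q} = {p, q, r, s}" "{s, p, q, r} = {p, q, r, s}"
      "{p, s, r, q} = {p, q, r, s}" by auto
  have sums: "q + s = r + p" "r + p = s + q" "s + q = p + r" "p + r = s + q"
    using sum by (simp_all add: add.commute)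
  note 1 = parallelogram_vertex[OF G sum dim]
  note 2 = parallelogram_vertex[OF G[folded rot(1)] sums(1) dim]
  note 3 = parallelogram_vertex[OF G[folded rot(2)] sums(2) dim]
  note 4 = parallelogram_vertex[OF G[folded rot(3)] sums(3) dim]
  note 5 = parallelogram_vertex[OF G[folded rot(4)] sums(4) dim]
  show ext: "{x. x extreme_point_of G} = {p, q, r, s}"
    using 1(1) 2(1) 3(1) 4(1) extreme_point_of_convex_hull unfolding G by blast
  show "adjacent_vertices G p x \<longleftrightarrow> x = q \<or> x = s"
  proof
    assume a: "adjacent_vertices G p x"
    then have "x \<in> {p, q, r, s}" using ext by (auto simp: adjacent_vertices_def)
    then show "x = q \<or> x = s" using a 1(4) by (auto simp: adjacent_vertices_def)
  qed (use 1 2 3 4 5 in \<open>auto simp: adjacent_vertices_def\<close>)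
qed

text \<open>The sum relations identify the diagonals and are what later fixes the planar coordinates
  of the corners.\<close>

lemma parallelogram_cases:
  fixes G :: "'a::euclidean_space set"
  assumes "parallelogram G" and u: "u extreme_point_of G" and w: "w extreme_point_of G" and "u \<noteq> w"
  obtains (opposite) v s where "{x. x extreme_point_of G} = {u, w, v, s}" "u + w = v + s"
      "v \<noteq> u" "v \<noteq> w" "s \<noteq> u" "s \<noteq> w"
  | (adjacent) v s where "{x. x extreme_point_of G} = {u, w, v, s}" "u + s = w + v"
      "v \<noteq> u" "v \<noteq> w" "s \<noteq> u" "s \<noteq> w"
      "\<And>x. adjacent_vertices G u x \<longleftrightarrow> x = w \<or> x = v" "\<And>x. adjacent_vertices G w x \<longleftrightarrow> x = u \<or> x = s"
proof -
  obtain p1 p2 p3 p4 where G0: "G = convex hull {p1, p2, p3, p4}" and sum0: "p1 + p3 = p2 + p4"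
    and dim: "aff_dim G = 2" using assms(1) by (auto simp: parallelogram_def)
  have "u \<in> {p1, p2, p3, p4}" using u G0 extreme_point_of_convex_hull by blast
  then obtain q r s where G: "G = convex hull {u, q, r, s}" and sum: "u + r = q + s"
  proof (elim insertE emptyE)
    assume "u = p1" then show ?thesis using that G0 sum0 by blast
  next
    assume "u = p2"
    then have "G = convex hull {u, p3, p4, p1}" "u + p4 = p3 + p1"
      using G0 sum0 by (simp_all add: insert_commute add.commute)
    then show ?thesis using that by blast
  next
    assume "u = p3"
    then have "G = convex hull {u, p4, p1, p2}" "u + p1 = p4 + p2"
      using G0 sum0 by (simp_all add: insert_commute add.commute)
    then show ?thesis using that by blast
  next
    assume "u = p4"
    then have "G = convex hull {u, p1, p2, p3}" "u + p2 = p1 + p3"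
      using G0 sum0 by (simp_all add: insert_commute add.commute)
    then show ?thesis using that by blast
  qed
  note ext = parallelogram_adjacent(1)[OF G sum dim]
  note adj = parallelogram_adjacent(2)[OF G sum dim]
  have dist: "distinct [u, q, r, s]" by (rule parallelogram_vertex(2)[OF G sum dim])
  have "w \<in> {u, q, r, s}" using w ext by auto
  then consider "w = q" | "w = r" | "w = s" using \<open>u \<noteq> w\<close> by auto
  then show ?thesis
  proof cases
    case 1
    have G': "G = convex hull {q, u, s, r}" and sum': "q + s = u + r"
      using G sum by (simp_all add: insert_commute)
    show ?thesis
      by (rule adjacent[of s r])
        (use 1 ext dist sum adj parallelogram_adjacent(2)[OF G' sum' dim] in \<open>auto simp: insert_commute\<close>)
  next
    case 2
    show ?thesis by (rule opposite[of q s]) (use 2 ext dist sum in \<open>auto simp: insert_commute\<close>)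
  next
    case 3
    have G': "G = convex hull {s, u, q, r}" and sum': "s + q = u + r"
      using G sum by (simp_all add: insert_commute add.commute)
    show ?thesis
      by (rule adjacent[of q r])
        (use 3 ext dist sum adj parallelogram_adjacent(2)[OF G' sum' dim] in \<open>auto simp: insert_commute add.commute\<close>)
  qed
qed

section \<open>Projection from a point\<close>

locale projection_edge =
  fixes c \<nu> \<xi> \<xi>' :: "real^'r" and \<beta> :: real and K :: "(real^'r) set"
  assumes sep_c: "\<nu> \<bullet> c < \<beta>" and sep_K: "\<And>y. y \<in> K \<Longrightarrow> \<beta> < \<nu> \<bullet> y"
    and convex_K: "convex K"
    and adj: "adjacent_vertices (projP c \<nu> \<beta> ` K) \<xi> \<xi>'"
begin

definition pl :: "real \<Rightarrow> real \<Rightarrow> real^'r" where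
  "pl s t = c + s *\<^sub>R (\<xi> - c) + t *\<^sub>R (\<xi>' - c)"

abbreviation "b \<equiv> \<beta> - \<nu> \<bullet> c"

lemma height_pos: "k \<in> K \<Longrightarrow> \<nu> \<bullet> (k - c) > 0"
  using sep_c sep_K[of k] by (simp add: inner_diff_right)

lemma proj_height: "k \<in> K \<Longrightarrow> \<nu> \<bullet> projP c \<nu> \<beta> k = \<beta>"
  using height_pos[of k] by (simp add: projP_def inner_add_right)

lemma vertices: "\<xi> extreme_point_of projP c \<nu> \<beta> ` K" "\<xi>' extreme_point_of projP c \<nu> \<beta> ` K" "\<xi> \<noteq> \<xi>'"
    "closed_segment \<xi> \<xi>' face_of projP c \<nu> \<beta> ` K"
  using adj by (auto simp: adjacent_vertices_def segment_convex_hull)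

lemma vertex_height: "\<nu> \<bullet> \<xi> = \<beta>" "\<nu> \<bullet> \<xi>' = \<beta>"
  using vertices(1,2) proj_height by (auto simp: extreme_point_of_def)

lemma pl_height: "\<nu> \<bullet> (pl s t - c) = (s + t) * b"
  by (simp add: pl_def inner_add_right inner_diff_right vertex_height algebra_simps)

text \<open>Height along \<open>\<nu>\<close> recovers \<open>s + t\<close>, because
  \<open>c\<close> is off the hyperplane; the rest follows from
  \<open>\<xi> \<noteq> \<xi>'\<close>.\<close>

lemma pl_inj: "pl s t = pl s' t' \<longleftrightarrow> s = s' \<and> t = t'"
proof
  assume eq: "pl s t = pl s' t'"
  have "(s + t) * b = (s' + t') * b" using arg_cong[OF eq, of "\<lambda>x. \<nu> \<bullet> (x - c)"] by (simp add: pl_height)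
  then have st: "t = s' + t' - s" using sep_c by simp
  have "(s - s') *\<^sub>R (\<xi> - \<xi>') = 0" using eq unfolding pl_def st by (simp add: algebra_simps)
  then show "s = s' \<and> t = t'" using vertices(3) st by simp
qed simp

text \<open>A point of the image on the line of the edge but outside the edge would put one of the
  extreme points strictly between two points of the image.\<close>

lemma edge_parameter:
  assumes "(1 - \<theta>) *\<^sub>R \<xi> + \<theta> *\<^sub>R \<xi>' \<in> projP c \<nu> \<beta> ` K" (is "?p \<in> _")
  shows "0 \<le> \<theta> \<and> \<theta> \<le> 1"
proof -
  have not_past: False if x: "x extreme_point_of \<Delta>" and y: "y \<in> \<Delta>" and ne: "x \<noteq> y"
    and p: "x + \<eta> *\<^sub>R (x - y) \<in> \<Delta>" and "\<eta> > 0" for x y \<Delta> and \<eta> :: real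
  proof -
    let ?q = "x + \<eta> *\<^sub>R (x - y)"
    have "x = (1 - \<eta> / (1 + \<eta>)) *\<^sub>R ?q + (\<eta> / (1 + \<eta>)) *\<^sub>R y"
    proof -
      have scale: "(1 + \<eta>) * (1 - \<eta> / (1 + \<eta>)) = 1" "(1 + \<eta>) * (\<eta> / (1 + \<eta>)) = \<eta>"
        using \<open>\<eta> > 0\<close> by (simp_all add: field_simps)
      have "(1 + \<eta>) *\<^sub>R ((1 - \<eta> / (1 + \<eta>)) *\<^sub>R q + (\<eta> / (1 + \<eta>)) *\<^sub>R y) = q + \<eta> *\<^sub>R y" for q
        by (simp only: scaleR_right_distrib scaleR_scaleR scale scaleR_one)
      then have "(1 + \<eta>) *\<^sub>R ((1 - \<eta> / (1 + \<eta>)) *\<^sub>R ?q + (\<eta> / (1 + \<eta>)) *\<^sub>R y) = ?q + \<eta> *\<^sub>R y" .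
      also have "\<dots> = (1 + \<eta>) *\<^sub>R x" by (simp add: algebra_simps)
      finally show ?thesis using \<open>\<eta> > 0\<close> by simp
    qed
    moreover have "?q \<noteq> y"
    proof
      assume "?q = y"
      then have "(1 + \<eta>) *\<^sub>R (x - y) = 0" by (simp add: algebra_simps)
      then show False using ne \<open>\<eta> > 0\<close> by simp
    qed
    ultimately have "x \<in> open_segment ?q y"
      unfolding in_segment using \<open>\<eta> > 0\<close> by (intro conjI exI[of _ "\<eta> / (1 + \<eta>)"]) auto
    then show False using x y p by (auto simp: extreme_point_of_def)
  qed
  have v: "\<xi> \<in> projP c \<nu> \<beta> ` K" "\<xi>' \<in> projP c \<nu> \<beta> ` K" using vertices by (auto simp: extreme_point_of_def)
  have 1: "?p = \<xi> + (- \<theta>) *\<^sub>R (\<xi> - \<xi>')" and 2: "?p = \<xi>' + (\<theta> - 1) *\<^sub>R (\<xi>' - \<xi>)"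
    by (simp_all add: algebra_simps)
  have "\<not> \<theta> < 0" using not_past[OF vertices(1) v(2) vertices(3), of "- \<theta>"] assms unfolding 1 by auto
  moreover have "\<not> \<theta> > 1"
    using not_past[OF vertices(2) v(1) vertices(3)[symmetric], of "\<theta> - 1"] assms unfolding 2 by auto
  ultimately show ?thesis by simp
qed

lemma proj_pl:
  assumes "s + t > 0" "z - c = r *\<^sub>R (pl s t - c)" "r > 0"
  shows "projP c \<nu> \<beta> z = (1 - t / (s + t)) *\<^sub>R \<xi> + (t / (s + t)) *\<^sub>R \<xi>'"
proof -
  have b: "b > 0" using sep_c by simp
  have h: "\<nu> \<bullet> (r *\<^sub>R (pl s t - c)) = r * ((s + t) * b)" by (simp add: pl_height)
  have "projP c \<nu> \<beta> z = c + (b / (r * ((s + t) * b))) *\<^sub>R (r *\<^sub>R (pl s t - c))"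
    by (simp only: projP_def assms(2) h)
  also have "\<dots> = c + (1 / (s + t)) *\<^sub>R (pl s t - c)" using b assms by simp
  also have "pl s t - c = (s + t) *\<^sub>R ((1 - t / (s + t)) *\<^sub>R \<xi> + (t / (s + t)) *\<^sub>R \<xi>' - c)"
  proof -
    have "(s + t) * (1 - t / (s + t)) = s" "(s + t) * (t / (s + t)) = t"
      using assms(1) by (simp_all add: field_simps)
    then have "(s + t) *\<^sub>R ((1 - t / (s + t)) *\<^sub>R \<xi> + (t / (s + t)) *\<^sub>R \<xi>' - c)
        = s *\<^sub>R \<xi> + t *\<^sub>R \<xi>' - (s + t) *\<^sub>R c"
      by (simp only: scaleR_right_diff_distrib scaleR_right_distrib scaleR_scaleR)
    then show ?thesis by (simp add: pl_def algebra_simps)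
  qed
  also have "c + (1 / (s + t)) *\<^sub>R \<dots> = (1 - t / (s + t)) *\<^sub>R \<xi> + (t / (s + t)) *\<^sub>R \<xi>'"
    using assms(1) by simp
  finally show ?thesis .
qed

lemma cone_quadrant:
  assumes "k \<in> K" "0 \<le> r" "pl s t - c = r *\<^sub>R (k - c)"
  shows "0 \<le> s \<and> 0 \<le> t"
proof (cases "r = 0")
  case True
  then have "pl s t = pl 0 0" using assms(3) by (simp add: pl_def)
  then show ?thesis using pl_inj by simp
next
  case False
  then have r: "r > 0" using assms(2) by simp
  have "(s + t) * b = r * (\<nu> \<bullet> (k - c))" using pl_height[of s t] assms(3) by simp
  moreover have "r * (\<nu> \<bullet> (k - c)) > 0" using r height_pos[OF assms(1)] by simp
  ultimately have "0 < (s + t) * b" by simp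
  then have st: "s + t > 0" using sep_c by (simp add: zero_less_mult_iff)
  have "k - c = (1 / r) *\<^sub>R (pl s t - c)" using r assms(3) by simp
  then have "projP c \<nu> \<beta> k = (1 - t / (s + t)) *\<^sub>R \<xi> + (t / (s + t)) *\<^sub>R \<xi>'"
    using proj_pl[OF st, of k "1 / r"] r by simp
  then have "0 \<le> t / (s + t) \<and> t / (s + t) \<le> 1" using edge_parameter assms(1) by (metis imageI)
  then show ?thesis using st by (auto simp: zero_le_divide_iff divide_le_eq)
qed

lemma segment_pl:
  assumes "k \<in> K" "projP c \<nu> \<beta> k \<in> closed_segment \<xi> \<xi>'"
  shows "\<exists>s t. k = pl s t"
proof -
  obtain \<theta> where th: "projP c \<nu> \<beta> k = (1 - \<theta>) *\<^sub>R \<xi> + \<theta> *\<^sub>R \<xi>'" using assms(2) by (auto simp: in_segment)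
  define h where "h = (\<nu> \<bullet> (k - c)) / b"
  have "k - c = h *\<^sub>R (projP c \<nu> \<beta> k - c)"
    using height_pos[OF assms(1)] sep_c by (simp add: projP_def h_def)
  then have "k = c + h *\<^sub>R ((1 - \<theta>) *\<^sub>R \<xi> + \<theta> *\<^sub>R \<xi>' - c)" unfolding th by (simp add: algebra_simps)
  then have "k = pl (h * (1 - \<theta>)) (h * \<theta>)" by (simp add: pl_def algebra_simps)
  then show ?thesis by blast
qed

lemma pl_segment:
  assumes "k \<in> K" "k = pl s t"
  shows "projP c \<nu> \<beta> k \<in> closed_segment \<xi> \<xi>'"
proof -
  have st: "0 \<le> s" "0 \<le> t" using cone_quadrant[of k 1 s t] assms by auto
  have "(s + t) * b > 0" using height_pos[OF assms(1)] pl_height[of s t] assms(2) by simp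
  then have "s + t > 0" using sep_c by (simp add: zero_less_mult_iff)
  then show ?thesis
    using proj_pl[of s t k 1] assms(2) st by (auto simp: in_segment intro!: exI[of _ "t / (s + t)"])
qed

text \<open>A weighted mean \<open>k3\<close> of \<open>k1\<close> and \<open>k2\<close> lies on the
  ray of the sum, so it projects into the edge. Its projection is strictly between those of
  \<open>k1\<close> and \<open>k2\<close> when these differ, and the edge is a face, so both project
  into the edge.\<close>

lemma cone_sum_plane:
  assumes k1: "k1 \<in> K" "x - c = r1 *\<^sub>R (k1 - c)" "0 \<le> r1"
    and k2: "k2 \<in> K" "y - c = r2 *\<^sub>R (k2 - c)" "0 \<le> r2"
    and sum: "x + y - c = pl s t"
  shows "\<exists>s t. x = pl s t"
proof (cases "r1 = 0 \<or> r2 = 0")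
  case True
  then show ?thesis
  proof
    assume "r1 = 0"
    then have "x = pl 0 0" using k1(2) by (simp add: pl_def)
    then show ?thesis by blast
  next
    assume "r2 = 0"
    then have "x = pl s t" using k2(2) sum by simp
    then show ?thesis by blast
  qed
next
  case False
  then have r: "r1 > 0" "r2 > 0" using k1 k2 by auto
  have b: "b > 0" using sep_c by simp
  define h1 where "h1 = r1 * (\<nu> \<bullet> (k1 - c))"
  define h2 where "h2 = r2 * (\<nu> \<bullet> (k2 - c))"
  have h: "h1 > 0" "h2 > 0" using r height_pos k1 k2 by (auto simp: h1_def h2_def)
  let ?p1 = "projP c \<nu> \<beta> k1" and ?p2 = "projP c \<nu> \<beta> k2"
  have p1: "x - c = (h1 / b) *\<^sub>R (?p1 - c)" and p2: "y - c = (h2 / b) *\<^sub>R (?p2 - c)"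
    using height_pos[OF k1(1)] height_pos[OF k2(1)] b k1(2) k2(2) by (simp_all add: projP_def h1_def h2_def)
  define k3 where "k3 = (r1 / (r1 + r2)) *\<^sub>R k1 + (r2 / (r1 + r2)) *\<^sub>R k2"
  have k3: "k3 \<in> K" unfolding k3_def
    using convex_K k1(1) k2(1) r by (intro convexD) (auto simp: add_divide_distrib[symmetric])
  have k12: "(r1 + r2) *\<^sub>R (k3 - c) = r1 *\<^sub>R (k1 - c) + r2 *\<^sub>R (k2 - c)"
    using r by (simp add: k3_def scaleR_right_diff_distrib scaleR_right_distrib) (simp add: algebra_simps)
  also have "\<dots> = (x - c) + (y - c)" by (simp only: k1(2) k2(2))
  also have "\<dots> = pl s t - c" unfolding sum[symmetric] by simp
  finally have k3c: "pl s t - c = (r1 + r2) *\<^sub>R (k3 - c)" by simp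
  let ?p3 = "projP c \<nu> \<beta> k3"
  have "k3 = pl (s / (r1 + r2)) (t / (r1 + r2))"
  proof -
    have "k3 - c = (1 / (r1 + r2)) *\<^sub>R (pl s t - c)" using k3c r by simp
    then show ?thesis by (simp add: pl_def algebra_simps)
  qed
  then have p3: "?p3 \<in> closed_segment \<xi> \<xi>'" using pl_segment k3 by blast
  have hk3: "(r1 + r2) * (\<nu> \<bullet> (k3 - c)) = h1 + h2"
  proof -
    have "\<nu> \<bullet> ((r1 + r2) *\<^sub>R (k3 - c)) = \<nu> \<bullet> (r1 *\<^sub>R (k1 - c) + r2 *\<^sub>R (k2 - c))"
      by (simp only: k12)
    then show ?thesis by (simp only: h1_def h2_def inner_scaleR_right inner_add_right)
  qed
  \<comment> \<open>Central projection is not affine: the weights of the projected points come from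
    the heights \<open>h1, h2\<close>, not from \<open>r1, r2\<close>.\<close>
  define \<theta> where "\<theta> = h2 / (h1 + h2)"
  have \<theta>: "0 < \<theta>" "\<theta> < 1" "1 - \<theta> = h1 / (h1 + h2)" using h by (auto simp: \<theta>_def field_simps)
  have p3eq: "?p3 = (1 - \<theta>) *\<^sub>R ?p1 + \<theta> *\<^sub>R ?p2"
  proof -
    have n3: "\<nu> \<bullet> (k3 - c) = (h1 + h2) / (r1 + r2)" using hk3 r by (simp add: field_simps)
    have "k3 - c = (1 / (r1 + r2)) *\<^sub>R (pl s t - c)" using k3c r by simp
    also have "pl s t - c = (x - c) + (y - c)" unfolding sum[symmetric] by simp
    also have "\<dots> = (h1 / b) *\<^sub>R (?p1 - c) + (h2 / b) *\<^sub>R (?p2 - c)" by (simp only: p1 p2)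
    finally have k3e: "k3 - c = (1 / (r1 + r2)) *\<^sub>R ((h1 / b) *\<^sub>R (?p1 - c) + (h2 / b) *\<^sub>R (?p2 - c))" .
    have "?p3 - c = (b / ((h1 + h2) / (r1 + r2))) *\<^sub>R (k3 - c)"
      by (simp only: projP_def n3 add_diff_cancel_left')
    also have "\<dots> = (b / ((h1 + h2) / (r1 + r2))) *\<^sub>R (1 / (r1 + r2)) *\<^sub>R
        ((h1 / b) *\<^sub>R (?p1 - c) + (h2 / b) *\<^sub>R (?p2 - c))"
      by (simp only: k3e)
    also have "\<dots> = (1 - \<theta>) *\<^sub>R (?p1 - c) + \<theta> *\<^sub>R (?p2 - c)"
      unfolding \<theta>(3) using r b h by (simp add: \<theta>_def scaleR_right_distrib)
    finally show ?thesis by (simp add: algebra_simps)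
  qed
  have "?p1 \<in> closed_segment \<xi> \<xi>'"
  proof (cases "?p1 = ?p2")
    case True
    then have "?p3 = ?p1" using p3eq by (simp add: scaleR_left_distrib[symmetric])
    then show ?thesis using p3 by simp
  next
    case False
    then have "?p3 \<in> open_segment ?p1 ?p2" using p3eq \<theta> by (auto simp: in_segment)
    then show ?thesis using vertices(4) p3 k1(1) k2(1) unfolding face_of_def by blast
  qed
  then obtain s' t' where k1pl: "k1 = pl s' t'" using segment_pl k1(1) by blast
  have "x = c + r1 *\<^sub>R (k1 - c)" by (simp add: k1(2)[symmetric])
  then have "x = pl (r1 * s') (r1 * t')" unfolding k1pl by (simp add: pl_def algebra_simps)
  then show ?thesis by blast
qed

end

section \<open>The superpotential\<close>

lemma Jform_sym: "Jform d p q = Jform d q p"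
  by (simp add: Jform_def mult.commute)

lemma Jform_add_right: "Jform d z (p + q) = Jform d z p + Jform d z q"
  by (simp add: Jform_def sum.distrib distrib_left add_divide_distrib)

lemma Jform_scaleR_right: "Jform d z (k *\<^sub>R p) = k * Jform d z p"
  by (simp add: Jform_def sum_distrib_left[symmetric] right_diff_distrib mult.left_commute
      times_divide_eq_right[symmetric] del: times_divide_eq_right)

lemma Jform_add_left: "Jform d (p + q) z = Jform d p z + Jform d q z"
  using Jform_add_right Jform_sym by metis

lemma Jform_scaleR_left: "Jform d (k *\<^sub>R p) z = k * Jform d p z"
  using Jform_scaleR_right Jform_sym by metis

lemma Jform_negative_definite:
  assumes pos: "\<And>i. d $ i > 0" and "(\<Sum>i\<in>UNIV. z $ i) = 0" and "z \<noteq> 0"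
  shows "Jform d z z < 0"
proof -
  obtain i where "z $ i \<noteq> 0" using assms(3) by (auto simp: vec_eq_iff)
  then have "z $ i * z $ i / d $ i > 0" using pos by (metis divide_pos_pos not_real_square_gt_zero)
  moreover have "z $ j * z $ j / d $ j \<ge> 0" for j using pos[of j] by simp
  ultimately have "(\<Sum>i\<in>UNIV. z $ i * z $ i / d $ i) > 0"
    by (intro sum_pos2[of UNIV i]) auto
  then show ?thesis using assms(2) by (simp add: Jform_def)
qed

text \<open>Points of \<open>C\<close> have equal coordinate sums, so their differences have sum
  zero, where the form is negative definite.\<close>

lemma superpotential_balanced:
  assumes pos: "\<And>i. d $ i > 0" and sp: "is_superpotential d W A C F"
  shows "balanced_set (Jform d) C {\<xi>. \<xi> - d \<in> W} F"
proof
  show "finite C" "\<And>x. x \<in> C \<Longrightarrow> F x \<noteq> 0"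
    using sp by (auto simp: is_superpotential_def)
  show "Jform d x y = Jform d y x" for x y by (rule Jform_sym)
  show "Jform d z p + Jform d z q = Jform d z x + Jform d z y" if "p + q = x + y" for p q x y z
    using that by (simp add: Jform_add_right[symmetric])
  show "pair_sum (Jform d) F C \<xi> = 0" if "\<xi> \<notin> {\<xi>. \<xi> - d \<in> W}" for \<xi>
    using that sp by (simp add: is_superpotential_def pair_sum_def)
  fix x y assume xy: "x \<in> C" "y \<in> C" "x \<noteq> y"
  have "(\<Sum>i\<in>UNIV. (x - y) $ i) = 0"
  proof -
    have "in_Hplane d x" "in_Hplane d y" using xy sp by (auto simp: is_superpotential_def)
    then show ?thesis by (simp add: in_Hplane_def sum_subtractf)
  qed
  then have "Jform d (x - y) (x - y) < 0" using xy(3) by (intro Jform_negative_definite pos) auto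
  moreover have "x - y = x + (- 1) *\<^sub>R y" by simp
  ultimately have "Jform d (x + (- 1) *\<^sub>R y) (x + (- 1) *\<^sub>R y) < 0" by (simp only:)
  then show "Jform d x x + Jform d y y < 2 * Jform d x y"
    using Jform_sym[of d y x]
    unfolding Jform_add_left Jform_add_right Jform_scaleR_left Jform_scaleR_right
    by (simp add: algebra_simps)
qed

theorem theorem6p4:
  fixes d :: "real^'r" and W C :: "(real^'r) set" and A F :: "real^'r \<Rightarrow> real"
    and c \<nu> \<xi> \<xi>' u w a a' :: "real^'r" and \<beta> :: real
    and K \<Delta> Fc G E :: "(real^'r) set"
  assumes r2: "CARD('r) \<ge> 2"
    and d_pos: "\<forall>i. d $ i \<in> \<nat> \<and> d $ i \<ge> 1"
    and W_fin: "finite W"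
    and W_types: "\<forall>x\<in>W. type_I x \<or> type_II x \<or> type_III x"
    and A_sign: "\<forall>x\<in>W. (type_I x \<longrightarrow> A x > 0) \<and> (\<not> type_I x \<longrightarrow> A x < 0)"
    and W_dim: "aff_dim (convex hull W) = int CARD('r) - 1"
    and superpot: "is_superpotential d W A C F"
    and K_def: "K \<equiv> convex hull (barv d ` W)"
    and c_in: "c \<in> C" and c_null: "null_vec d c"
    and c_vertex: "c extreme_point_of (convex hull C)"
    and sep_c: "\<nu> \<bullet> c < \<beta>"
    and sep_K: "\<forall>y\<in>K. \<beta> < \<nu> \<bullet> y"
    and \<Delta>_def: "\<Delta> \<equiv> projP c \<nu> \<beta> ` K"
    and adj: "adjacent_vertices \<Delta> \<xi> \<xi>'"
    and t1B: "type_1B d C K c \<xi>" and t1B': "type_1B d C K c \<xi>'"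
    and u_in: "u \<in> W" and w_in: "w \<in> W"
    and line_u: "affine hull {c, \<xi>} \<inter> K = {barv d u}"
    and line_w: "affine hull {c, \<xi>'} \<inter> K = {barv d w}"
    and a_in: "a \<in> C" and a_null: "null_vec d a" and u_eq: "barv d u = (1/2) *\<^sub>R (a + c)"
    and a'_in: "a' \<in> C" and a'_null: "null_vec d a'" and w_eq: "barv d w = (1/2) *\<^sub>R (a' + c)"
    and Fc_def: "Fc \<equiv> {z\<in>K. projP c \<nu> \<beta> z \<in> closed_segment \<xi> \<xi>'}"
    and Fc_face: "Fc face_of K" and Fc_dim: "aff_dim Fc = 2"
    and G_def: "G \<equiv> {x\<in>convex hull W. barv d x \<in> Fc}"
    and G_par: "parallelogram G"
    and G_W: "W \<inter> G = {x. x extreme_point_of G}"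
    and E_def: "E \<equiv> affine hull Fc"
  shows "adjacent_vertices G u w \<and>
    (\<exists>v s. adjacent_vertices G u v \<and> v \<noteq> w \<and> adjacent_vertices G w s \<and> s \<noteq> u) \<and>
    (\<forall>v s. adjacent_vertices G u v \<and> v \<noteq> w \<and> adjacent_vertices G w s \<and> s \<noteq> u \<longrightarrow>
       (((\<exists>e. null_vec d e \<and> C \<inter> E = {c, a, a', e} \<and>
              barv d v = (1/2) *\<^sub>R (a + e) \<and> barv d s = (1/2) *\<^sub>R (a' + e))
         \<or> (barv d v \<in> C \<and> barv d s \<in> C \<and> Jform d a (barv d v) = 0 \<and>
            Jform d a' (barv d s) = 0 \<and> Jform d (barv d s) (barv d v) = 0))
       \<and> (\<not> type_I v \<and> \<not> type_I u \<and> \<not> type_I s \<and> \<not> type_I w \<longrightarrow>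
            \<not> (\<exists>e. null_vec d e \<and> C \<inter> E = {c, a, a', e} \<and>
              barv d v = (1/2) *\<^sub>R (a + e) \<and> barv d s = (1/2) *\<^sub>R (a' + e)))))"
proof -
  have dpos: "d $ i > 0" for i using d_pos by (meson less_le_trans zero_less_one)
  let ?M = "{\<xi>. \<xi> - d \<in> W}"
  interpret C: balanced_set "Jform d" C ?M F by (rule superpotential_balanced[OF dpos superpot])
  have sums: "pair_sum (Jform d) F C \<xi> = A (\<xi> - d)" if "\<xi> \<in> ?M" for \<xi>
    using superpot that by (simp add: is_superpotential_def pair_sum_def)
  have A0: "A x \<noteq> 0" if "x \<in> W" for x using A_sign that by fastforce
  \<comment> \<open>The right side of the equation at \<open>d + x\<close> is
    \<open>A x \<noteq> 0\<close>, so the sum there is not empty.\<close>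
  have Msum: "\<exists>p\<in>C. \<exists>q\<in>C. p + q = \<xi>" if "\<xi> \<in> ?M" for \<xi>
  proof (rule ccontr)
    assume "\<not> ?thesis"
    then have "{p \<in> C \<times> C. fst p + snd p = \<xi>} = {}" by auto
    then have "pair_sum (Jform d) F C \<xi> = 0" by (simp only: pair_sum_def sum.empty)
    then show False using sums[OF that] A0 that by simp
  qed
  have barvK: "barv d x \<in> K" if "x \<in> W" for x unfolding K_def using that by (simp add: hull_inc)
  have MK: "(1/2) *\<^sub>R \<xi> \<in> K" if "\<xi> \<in> ?M" for \<xi> using barvK[of "\<xi> - d"] that by (simp add: barv_def)
  have "compact K" "convex K" using W_fin unfolding K_def by (simp_all add: finite_imp_compact_convex_hull)
  moreover have "K \<noteq> {}" "c \<notin> K" using barvK[OF u_in] sep_K sep_c by (blast, meson less_asym)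
  ultimately have K: "compact K" "convex K" "K \<noteq> {}" "c \<notin> K" by auto
  have Jcc: "Jform d c c = 0" and Jaa: "Jform d a a = 0" and Jaa': "Jform d a' a' = 0"
    using c_null a_null a'_null by (simp_all add: null_vec_def)
  have cone: "\<exists>r k. 0 \<le> r \<and> k \<in> K \<and> x - c = r *\<^sub>R (k - c)" if "x \<in> C" for x
    using null_vertex_cone[OF C.balanced_set_axioms Msum MK K c_in Jcc c_vertex that] by metis
  interpret pe: projection_edge c \<nu> \<xi> \<xi>' \<beta> K
    by unfold_locales (use sep_c sep_K K(2) adj[unfolded \<Delta>_def] in auto)
  have ray: "\<exists>y>0. barv d x = c + y *\<^sub>R (\<zeta> - c)"
    if "x \<in> W" "affine hull {c, \<zeta>} \<inter> K = {barv d x}" "\<nu> \<bullet> \<zeta> = \<beta>" for x \<zeta>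
  proof -
    have "barv d x \<in> affine hull {c, \<zeta>}" using that(2) by blast
    then obtain p y where py: "p + y = 1" "barv d x = p *\<^sub>R c + y *\<^sub>R \<zeta>"
      by (auto simp: affine_hull_2)
    have p: "p = 1 - y" using py(1) by simp
    have e: "barv d x = c + y *\<^sub>R (\<zeta> - c)" unfolding py(2) p by (simp add: algebra_simps)
    have "0 < \<nu> \<bullet> (barv d x - c)" using pe.height_pos barvK that(1) by blast
    then have "0 < y * pe.b" using that(3) by (simp add: e inner_diff_right)
    then have "y > 0" using sep_c by (simp add: zero_less_mult_iff)
    then show ?thesis using e by blast
  qed
  obtain y1 where y1: "y1 > 0" "barv d u = c + y1 *\<^sub>R (\<xi> - c)"
    using ray[OF u_in line_u pe.vertex_height(1)] by blast
  obtain y2 where y2: "y2 > 0" "barv d w = c + y2 *\<^sub>R (\<xi>' - c)"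
    using ray[OF w_in line_w pe.vertex_height(2)] by blast
  \<comment> \<open>The factor 2 puts \<open>a\<close> and \<open>a'\<close>, rather than the
    midpoints \<open>barv d u\<close> and \<open>barv d w\<close>, at \<open>(1,0)\<close> and
    \<open>(0,1)\<close>.\<close>
  define \<phi> where "\<phi> p = pe.pl (2 * y1 * fst p) (2 * y2 * snd p)" for p :: "real \<times> real"
  have "a = 2 *\<^sub>R barv d u - c" "a' = 2 *\<^sub>R barv d w - c"
    using u_eq w_eq by simp_all
  then have \<phi>v: "\<phi> (0,0) = c" "\<phi> (1,0) = a" "\<phi> (0,1) = a'"
    unfolding y1(2) y2(2) \<phi>_def pe.pl_def by (simp_all add: algebra_simps scaleR_2)
  have \<phi>bary: "\<phi> p = (1 - fst p - snd p) *\<^sub>R c + fst p *\<^sub>R a + snd p *\<^sub>R a'" for p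
    unfolding \<phi>v[symmetric] unfolding \<phi>_def pe.pl_def by (simp add: algebra_simps)
  have \<phi>inj: "\<phi> p = \<phi> q \<longleftrightarrow> p = q" for p q
    using y1(1) y2(1) by (simp add: \<phi>_def pe.pl_inj prod_eq_iff)
  have \<phi>add: "\<phi> p + \<phi> q = c + \<phi> (p + q)" for p q
    unfolding \<phi>_def pe.pl_def by (simp add: algebra_simps)
  have \<phi>half: "(1/2) *\<^sub>R (c + \<phi> p) = \<phi> (fst p / 2, snd p / 2)" for p
  proof -
    have "c + \<phi> p = \<phi> (fst p / 2, snd p / 2) + \<phi> (fst p / 2, snd p / 2)" by (simp add: \<phi>add)
    then show ?thesis by (simp add: scaleR_2[symmetric])
  qed
  have pl_range: "pe.pl s t \<in> range \<phi>" for s t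
  proof -
    have "pe.pl s t = \<phi> (s / (2 * y1), t / (2 * y2))" using y1(1) y2(1) by (simp add: \<phi>_def)
    then show ?thesis by simp
  qed
  have \<phi>pl: "\<exists>s t. \<phi> p = pe.pl s t" for p by (auto simp: \<phi>_def)
  have FcK: "Fc = K \<inter> range \<phi>"
    unfolding Fc_def using pe.segment_pl pe.pl_segment pl_range \<phi>pl by (fastforce)
  have E: "E = range \<phi>"
  proof -
    have hull: "affine hull {c, \<xi>, \<xi>'} = range \<phi>"
    proof (intro equalityI subsetI)
      fix x assume "x \<in> affine hull {c, \<xi>, \<xi>'}"
      then obtain p s t where pst: "x = p *\<^sub>R c + s *\<^sub>R \<xi> + t *\<^sub>R \<xi>'" "p + s + t = 1"
        by (auto simp: affine_hull_3)
      have p: "p = 1 - s - t" using pst(2) by simp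
      have "x = pe.pl s t" unfolding pst(1) p pe.pl_def by (simp add: algebra_simps)
      then show "x \<in> range \<phi>" using pl_range by simp
    next
      fix x assume "x \<in> range \<phi>"
      then obtain s t where x: "x = pe.pl s t" using \<phi>pl by blast
      have "x = (1 - s - t) *\<^sub>R c + s *\<^sub>R \<xi> + t *\<^sub>R \<xi>'" unfolding x pe.pl_def by (simp add: algebra_simps)
      then show "x \<in> affine hull {c, \<xi>, \<xi>'}" unfolding affine_hull_3
        by (intro CollectI exI[of _ "1 - s - t"] exI[of _ s] exI[of _ t]) simp
    qed
    \<comment> \<open>The plane through \<open>c, \<xi>, \<xi>'\<close> contains \<open>Fc\<close>,
      and equal dimension makes the affine hulls coincide.\<close>
    have sub: "affine hull Fc \<subseteq> affine hull {c, \<xi>, \<xi>'}"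
      by (rule hull_minimal) (use FcK hull in blast, simp)
    have "aff_dim {c, \<xi>, \<xi>'} \<le> int (card {c, \<xi>, \<xi>'}) - 1" by (rule aff_dim_le_card) simp
    moreover have "card {c, \<xi>, \<xi>'} \<le> 3" by (simp add: card_insert_if)
    ultimately have "aff_dim (affine hull {c, \<xi>, \<xi>'}) \<le> 2" by simp
    then have "aff_dim (affine hull Fc) = aff_dim (affine hull {c, \<xi>, \<xi>'})"
      using aff_dim_subset[OF sub] Fc_dim by simp
    moreover have "affine hull Fc \<noteq> {}" using Fc_dim by auto
    ultimately have "affine hull Fc = affine hull {c, \<xi>, \<xi>'}"
      using sub by (intro affine_dim_equal) auto
    then show ?thesis using hull unfolding E_def by simp
  qed
  let ?CE = "C \<inter> range \<phi>"
  \<comment> \<open>All of \<open>C\<close> lies in the cone over \<open>K\<close>, where a sum can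
    enter the plane only if both summands do.\<close>
  have face: "p \<in> ?CE" if f: "x \<in> ?CE" "y \<in> ?CE" "p \<in> C" "q \<in> C" "p + q = x + y" for x y p q
  proof -
    obtain z z' where "x = \<phi> z" "y = \<phi> z'" using f(1,2) by blast
    then have "p + q - c = \<phi> (z + z')" using f(5) \<phi>add by simp
    then obtain s t where st: "p + q - c = pe.pl s t" using \<phi>pl by metis
    obtain r1 k1 where 1: "k1 \<in> K" "p - c = r1 *\<^sub>R (k1 - c)" "0 \<le> r1" using cone[OF f(3)] by blast
    obtain r2 k2 where 2: "k2 \<in> K" "q - c = r2 *\<^sub>R (k2 - c)" "0 \<le> r2" using cone[OF f(4)] by blast
    have "p \<in> range \<phi>" using pe.cone_sum_plane[OF 1 2 st] pl_range by metis
    then show ?thesis using f(3) by simp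
  qed
  interpret CE: balanced_set "Jform d" ?CE ?M F by (rule C.face_balanced[OF Int_lower1 face])
  define D where "D = \<phi> -` ?CE"
  have D_iff: "p \<in> D \<longleftrightarrow> \<phi> p \<in> C" for p by (simp add: D_def)
  \<comment> \<open>The shift by \<open>c\<close> reflects
    \<open>\<phi> p + \<phi> q = c + \<phi> (p + q)\<close>.\<close>
  define M where "M = (\<lambda>\<zeta>. c + \<phi> \<zeta>) -` ?M"
  let ?J = "\<lambda>p q. Jform d (\<phi> p) (\<phi> q)"
  have inj: "inj \<phi>" "inj (\<lambda>\<zeta>. c + \<phi> \<zeta>)" using \<phi>inj by (auto simp: inj_def)
  have bs: "balanced_set ?J D M (F \<circ> \<phi>)"
    unfolding D_def M_def by (rule CE.vimage_balanced[OF inj(1) _ \<phi>add inj(2)]) auto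
  have psum: "pair_sum ?J (F \<circ> \<phi>) D \<zeta> = A (c + \<phi> \<zeta> - d)"
    and Msum': "\<exists>p\<in>D. \<exists>q\<in>D. p + q = \<zeta>" if z: "\<zeta> \<in> M" for \<zeta>
  proof -
    have zM: "c + \<phi> \<zeta> \<in> ?M" using z by (simp add: M_def)
    obtain p q where pq: "p \<in> C" "q \<in> C" "p + q = c + \<phi> \<zeta>" using Msum[OF zM] by blast
    have "p + q - c = \<phi> \<zeta>" "q + p - c = \<phi> \<zeta>" using pq(3) by (simp_all add: algebra_simps)
    then obtain s t where st: "p + q - c = pe.pl s t" "q + p - c = pe.pl s t" using \<phi>pl by metis
    obtain r1 k1 where 1: "k1 \<in> K" "p - c = r1 *\<^sub>R (k1 - c)" "0 \<le> r1" using cone[OF pq(1)] by blast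
    obtain r2 k2 where 2: "k2 \<in> K" "q - c = r2 *\<^sub>R (k2 - c)" "0 \<le> r2" using cone[OF pq(2)] by blast
    have "p \<in> range \<phi>" "q \<in> range \<phi>"
      using pe.cone_sum_plane[OF 1 2 st(1)] pe.cone_sum_plane[OF 2 1 st(2)] pl_range by metis+
    then have pq': "p \<in> ?CE" "q \<in> ?CE" using pq by auto
    have "pair_sum ?J (F \<circ> \<phi>) D \<zeta> = pair_sum (Jform d) F ?CE (c + \<phi> \<zeta>)"
      unfolding D_def by (rule pair_sum_vimage[OF inj(1) _ \<phi>add inj(2)]) auto
    also have "\<dots> = pair_sum (Jform d) F C (c + \<phi> \<zeta>)"
      by (rule pair_sum_face[OF Int_lower1 pq' pq(3) face])
    finally show "pair_sum ?J (F \<circ> \<phi>) D \<zeta> = A (c + \<phi> \<zeta> - d)" using sums[OF zM] by simp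
    obtain p' q' where p'q': "p = \<phi> p'" "q = \<phi> q'" using pq' by blast
    then have "\<phi> (p' + q') = \<phi> \<zeta>" using pq(3) \<phi>add[of p' q'] by simp
    then have "p' + q' = \<zeta>" using \<phi>inj by blast
    moreover have "p' \<in> D" "q' \<in> D" using pq' p'q' by (simp_all add: D_def)
    ultimately show "\<exists>p\<in>D. \<exists>q\<in>D. p + q = \<zeta>" by blast
  qed
  have quadrant: "0 \<le> fst p \<and> 0 \<le> snd p" if "\<phi> p - c = r *\<^sub>R (k - c)" "0 \<le> r" "k \<in> K" for p r k
    using pe.cone_quadrant[OF that(3,2), of "2 * y1 * fst p" "2 * y2 * snd p"] that(1) y1(1) y2(1)
    by (simp add: \<phi>_def zero_le_mult_iff)
  have barv_\<phi>: "barv d (c + \<phi> \<zeta> - d) = \<phi> (fst \<zeta> / 2, snd \<zeta> / 2)" for \<zeta>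
    using \<phi>half[of \<zeta>] by (simp add: barv_def)
  have M_half: "\<phi> (fst \<zeta> / 2, snd \<zeta> / 2) \<in> K" if "\<zeta> \<in> M" for \<zeta>
    using barvK[of "c + \<phi> \<zeta> - d"] barv_\<phi>[of \<zeta>] that by (simp add: M_def)
  have bu: "barv d u = \<phi> (1/2, 0)" and bw: "barv d w = \<phi> (0, 1/2)"
    using u_eq w_eq \<phi>half[of "(1,0)"] \<phi>half[of "(0,1)"] \<phi>v by (simp_all add: add.commute)
  \<comment> \<open>The two axes are the lines from \<open>c\<close> through \<open>\<xi>\<close>
    and \<open>\<xi>'\<close>, each of which meets \<open>K\<close> in a single point.\<close>
  have axes: "(x, 0) \<in> M \<Longrightarrow> x = 1" "(0, y) \<in> M \<Longrightarrow> y = 1" for x y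
  proof -
    assume "(x, 0) \<in> M"
    then have "\<phi> (x / 2, 0) \<in> K" using M_half by force
    moreover have "\<phi> (x / 2, 0) \<in> affine hull {c, \<xi>}"
      unfolding affine_hull_2 \<phi>_def pe.pl_def
      by (intro CollectI exI[of _ "1 - y1 * x"] exI[of _ "y1 * x"]) (simp add: algebra_simps)
    ultimately have "\<phi> (x / 2, 0) = \<phi> (1/2, 0)" using line_u bu by (metis IntI singletonD)
    then show "x = 1" unfolding \<phi>inj by simp
  next
    assume "(0, y) \<in> M"
    then have "\<phi> (0, y / 2) \<in> K" using M_half by force
    moreover have "\<phi> (0, y / 2) \<in> affine hull {c, \<xi>'}"
      unfolding affine_hull_2 \<phi>_def pe.pl_def
      by (intro CollectI exI[of _ "1 - y2 * y"] exI[of _ "y2 * y"]) (simp add: algebra_simps)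
    ultimately have "\<phi> (0, y / 2) = \<phi> (0, 1/2)" using line_w bw by (metis IntI singletonD)
    then show "y = 1" unfolding \<phi>inj by simp
  qed
  interpret pl: planar_set ?J D M "F \<circ> \<phi>" "Jform d c a" "Jform d c a'" "Jform d a a'"
  proof (intro planar_set.intro bs planar_set_axioms.intro)
    show "?J p q = Jform d c a * ((1 - fst p - snd p) * fst q + fst p * (1 - fst q - snd q))
      + Jform d c a' * ((1 - fst p - snd p) * snd q + snd p * (1 - fst q - snd q))
      + Jform d a a' * (fst p * snd q + snd p * fst q)" for p q
      unfolding \<phi>bary Jform_add_left Jform_add_right Jform_scaleR_left Jform_scaleR_right
        Jcc Jaa Jaa' Jform_sym[of d a c] Jform_sym[of d a' c] Jform_sym[of d a' a]
      by algebra
    show "0 \<le> fst p \<and> 0 \<le> snd p" if "p \<in> D" for p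
    proof -
      have "\<phi> p \<in> C" using that by (simp add: D_def)
      then show ?thesis using cone quadrant by blast
    qed
    show "(0,0) \<in> D" "(1,0) \<in> D" "(0,1) \<in> D"
      using c_in a_in a'_in by (simp_all add: D_iff \<phi>v)
  qed (fact axes)+
  let ?Ext = "{x. x extreme_point_of G}"
  have M_Ext: "c + \<phi> \<zeta> - d \<in> ?Ext" if "\<zeta> \<in> M" for \<zeta>
  proof -
    let ?x = "c + \<phi> \<zeta> - d"
    have xW: "?x \<in> W" using that by (simp add: M_def)
    have "barv d ?x \<in> Fc" unfolding FcK using M_half[OF that] barv_\<phi>[of \<zeta>] by simp
    then have "?x \<in> G" unfolding G_def using xW by (simp add: hull_inc)
    then show ?thesis using xW G_W by blast
  qed
  have "\<exists>\<zeta>. c + \<phi> \<zeta> = d + x" if "x \<in> ?Ext" for x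
  proof -
    have "x \<in> G" using that G_W by blast
    then obtain p where p: "barv d x = \<phi> p" using FcK unfolding G_def by blast
    have "c + \<phi> (p + p) = \<phi> p + \<phi> p" by (simp add: \<phi>add)
    also have "\<dots> = d + x" unfolding p[symmetric] by (simp add: barv_def scaleR_2[symmetric])
    finally show ?thesis by blast
  qed
  \<comment> \<open>\<open>Z x\<close> is the total in planar coordinates belonging to the corner
    \<open>x\<close>, so \<open>M\<close> consists of the images of the four corners.\<close>
  then obtain Z where Z: "\<And>x. x \<in> ?Ext \<Longrightarrow> c + \<phi> (Z x) = d + x" by metis
  have ZM: "M = Z ` ?Ext"
  proof (intro equalityI subsetI)
    fix \<zeta> assume z: "\<zeta> \<in> M"
    have "c + \<phi> (Z (c + \<phi> \<zeta> - d)) = c + \<phi> \<zeta>" using Z[OF M_Ext[OF z]] by simp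
    then have "\<zeta> = Z (c + \<phi> \<zeta> - d)" using \<phi>inj by simp
    then show "\<zeta> \<in> Z ` ?Ext" using M_Ext[OF z] by blast
  next
    fix \<zeta> assume "\<zeta> \<in> Z ` ?Ext"
    then obtain x where x: "x \<in> ?Ext" "\<zeta> = Z x" by blast
    then have "x \<in> W" using G_W by blast
    then show "\<zeta> \<in> M" using Z[OF x(1)] x(2) by (simp add: M_def)
  qed
  have Zuniq: "Z x = \<zeta>" if "x \<in> ?Ext" "d + x = c + \<phi> \<zeta>" for x \<zeta>
    using Z[OF that(1)] that(2) \<phi>inj by simp
  have in_Ext: "x \<in> ?Ext" if "x \<in> W" "barv d x \<in> range \<phi>" for x
  proof -
    have "x \<in> G" unfolding G_def FcK using that barvK hull_inc[of x W convex] by simp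
    then show ?thesis using G_W that(1) by blast
  qed
  have uE: "u \<in> ?Ext" and wE: "w \<in> ?Ext" using in_Ext u_in w_in bu bw by auto
  have dbl: "2 *\<^sub>R barv d x = d + x" for x by (simp add: barv_def)
  have du: "d + u = c + a" and dw: "d + w = c + a'"
    using dbl[of u] dbl[of w] u_eq w_eq by (simp_all add: add.commute)
  have Zu: "Z u = (1,0)" by (rule Zuniq[OF uE]) (simp add: du \<phi>v)
  have Zw: "Z w = (0,1)" by (rule Zuniq[OF wE]) (simp add: dw \<phi>v)
  have uw: "u \<noteq> w" using Zu Zw by auto
  have Zpos: "fst (Z x) > 0 \<and> snd (Z x) > 0" if x: "x \<in> ?Ext" "x \<noteq> u" "x \<noteq> w" for x
  proof -
    have zM: "Z x \<in> M" using ZM x(1) by blast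
    have "\<phi> (fst (Z x) / 2, snd (Z x) / 2) - c = 1 *\<^sub>R (\<phi> (fst (Z x) / 2, snd (Z x) / 2) - c)" by simp
    from quadrant[OF this _ M_half[OF zM]] have "0 \<le> fst (Z x)" "0 \<le> snd (Z x)" by auto
    moreover have "snd (Z x) \<noteq> 0"
    proof
      assume "snd (Z x) = 0"
      then have "Z x = (1,0)" using zM axes(1)[of "fst (Z x)"] by (cases "Z x") auto
      then have "d + x = d + u" using Z[OF x(1)] Z[OF uE] Zu by simp
      then show False using x(2) by simp
    qed
    moreover have "fst (Z x) \<noteq> 0"
    proof
      assume "fst (Z x) = 0"
      then have "Z x = (0,1)" using zM axes(2)[of "snd (Z x)"] by (cases "Z x") auto
      then have "d + x = d + w" using Z[OF x(1)] Z[OF wE] Zw by simp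
      then show False using x(3) by simp
    qed
    ultimately show ?thesis by simp
  qed
  have Zadd: "Z x + Z y = Z x' + Z y'"
    if "x \<in> ?Ext" "y \<in> ?Ext" "x' \<in> ?Ext" "y' \<in> ?Ext" "x + y = x' + y'" for x y x' y'
  proof -
    have "(c + \<phi> (Z x)) + (c + \<phi> (Z y)) = (c + \<phi> (Z x')) + (c + \<phi> (Z y'))"
      using that(5) by (simp only: Z[OF that(1)] Z[OF that(2)] Z[OF that(3)] Z[OF that(4)]) (simp add: algebra_simps)
    then have "\<phi> (Z x) + \<phi> (Z y) = \<phi> (Z x') + \<phi> (Z y')" by (simp add: algebra_simps)
    then show ?thesis unfolding \<phi>add using \<phi>inj by simp
  qed
  have uE': "u extreme_point_of G" and wE': "w extreme_point_of G" using uE wE by auto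
  show ?thesis
    using G_par uE' wE' uw
  proof (cases rule: parallelogram_cases)
    case (opposite v s)
    have vs: "v \<in> ?Ext" "s \<in> ?Ext" using opposite by auto
    have sum: "Z u + Z w = Z v + Z s" by (rule Zadd[OF uE wE vs opposite(2)])
    then have Zs: "Z s = (1 - fst (Z v), 1 - snd (Z v))"
      unfolding Zu Zw by (cases "Z v"; cases "Z s") auto
    have "M = {(1,0), (0,1), (fst (Z v), snd (Z v)), (1 - fst (Z v), 1 - snd (Z v))}"
      unfolding ZM opposite(1) by (simp add: Zu Zw Zs)
    moreover have "0 < fst (Z v)" "fst (Z v) < 1" "0 < snd (Z v)" "snd (Z v) < 1"
      using Zpos[of v] Zpos[of s] vs opposite Zs by auto
    ultimately show ?thesis using pl.no_opposite_targets by blast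
  next
    case (adjacent v s)
    have vs: "v \<in> ?Ext" "s \<in> ?Ext" using adjacent by auto
    \<comment> \<open>The equality of diagonal sums leaves two free parameters for the remaining
      corners, namely the coordinates of \<open>(P,Q)\<close>.\<close>
    define P where "P = fst (Z s)"
    define Q where "Q = snd (Z v)"
    have "Z u + Z s = Z w + Z v" by (rule Zadd[OF uE vs(2) wE vs(1) adjacent(2)])
    then have Zv: "Z v = (1+P, Q)" and Zs: "Z s = (P, 1+Q)"
      unfolding Zu Zw P_def Q_def by (cases "Z v"; cases "Z s"; auto)+
    have MPQ: "M = {(1,0), (0,1), (1+P,Q), (P,1+Q)}"
      unfolding ZM adjacent(1) by (simp add: Zu Zw Zs Zv)
    interpret pp: planar_parallelogram ?J D M "F \<circ> \<phi>" "Jform d c a" "Jform d c a'" "Jform d a a'" P Q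
      by unfold_locales (use Zpos[of v] Zpos[of s] vs adjacent MPQ Msum' in \<open>auto simp: P_def Q_def\<close>)
    let ?e = "\<phi> (P,Q)"
    have dv: "d + v = a + ?e" and ds: "d + s = a' + ?e"
      using Z[OF vs(1)] Z[OF vs(2)] \<phi>add[of "(1,0)" "(P,Q)"] \<phi>add[of "(0,1)" "(P,Q)"]
      by (simp_all add: Zv Zs \<phi>v)
    have bv: "barv d v = \<phi> ((1+P)/2, Q/2)" and bs': "barv d s = \<phi> (P/2, (1+Q)/2)"
      using barv_\<phi>[of "(1+P,Q)"] barv_\<phi>[of "(P,1+Q)"] Z[OF vs(1)] Z[OF vs(2)] by (simp_all add: Zv Zs)
    have CE: "C \<inter> E = \<phi> ` D" unfolding E D_def by auto
    have dich: "(\<exists>e. null_vec d e \<and> C \<inter> E = {c, a, a', e} \<and>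
              barv d v = (1/2) *\<^sub>R (a + e) \<and> barv d s = (1/2) *\<^sub>R (a' + e))
         \<or> (barv d v \<in> C \<and> barv d s \<in> C \<and> Jform d a (barv d v) = 0 \<and>
            Jform d a' (barv d s) = 0 \<and> Jform d (barv d s) (barv d v) = 0)"
      using pp.parallelogram_dichotomy
    proof (elim disjE conjE)
      assume "Jform d ?e ?e = 0" "D = {(0,0), (1,0), (0,1), (P,Q)}"
      then have "null_vec d ?e" "C \<inter> E = {c, a, a', ?e}" by (simp_all add: null_vec_def CE \<phi>v)
      moreover have "barv d v = (1/2) *\<^sub>R (a + ?e)" "barv d s = (1/2) *\<^sub>R (a' + ?e)"
        by (simp_all only: barv_def dv ds)
      ultimately show ?thesis by blast
    next
      assume "((1+P)/2, Q/2) \<in> D" "(P/2, (1+Q)/2) \<in> D" "?J (1,0) ((1+P)/2, Q/2) = 0"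
        "?J (0,1) (P/2, (1+Q)/2) = 0" "?J (P/2, (1+Q)/2) ((1+P)/2, Q/2) = 0"
      then show ?thesis by (simp add: D_def bv bs' \<phi>v)
    qed
    have not_all_neg: "\<not> (\<exists>e. null_vec d e \<and> C \<inter> E = {c, a, a', e} \<and>
              barv d v = (1/2) *\<^sub>R (a + e) \<and> barv d s = (1/2) *\<^sub>R (a' + e))"
      if nI: "\<not> type_I v \<and> \<not> type_I u \<and> \<not> type_I s \<and> \<not> type_I w"
    proof
      assume "\<exists>e. null_vec d e \<and> C \<inter> E = {c, a, a', e} \<and>
              barv d v = (1/2) *\<^sub>R (a + e) \<and> barv d s = (1/2) *\<^sub>R (a' + e)"
      then obtain e where e: "null_vec d e" "C \<inter> E = {c, a, a', e}" "barv d v = (1/2) *\<^sub>R (a + e)"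
        by blast
      have "a + e = a + ?e" using e(3) dbl[of v] dv by simp
      then have ee: "e = ?e" by simp
      have "\<phi> ` D = \<phi> ` {(0,0), (1,0), (0,1), (P,Q)}" using e(2) ee by (simp add: CE \<phi>v)
      then have D4: "D = {(0,0), (1,0), (0,1), (P,Q)}" using inj(1) by (simp only: inj_image_eq_iff)
      show False
      proof (rule pp.quadrilateral_not_all_negative[OF D4])
        show "?J (P,Q) (P,Q) = 0" using e(1) ee by (simp add: null_vec_def)
        fix \<zeta> assume z: "\<zeta> \<in> M"
        have "c + \<phi> \<zeta> - d \<in> {u, w, v, s}" using M_Ext[OF z] adjacent(1) by simp
        then have "\<not> type_I (c + \<phi> \<zeta> - d)" using nI by auto
        moreover have "c + \<phi> \<zeta> - d \<in> W" using z by (simp add: M_def)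
        ultimately show "pair_sum ?J (F \<circ> \<phi>) D \<zeta> < 0" using psum[OF z] A_sign by simp
      qed
    qed
    have other: "v' = v \<and> s' = s"
      if "adjacent_vertices G u v' \<and> v' \<noteq> w \<and> adjacent_vertices G w s' \<and> s' \<noteq> u" for v' s'
      using that adjacent(7,8) by blast
    have adj': "adjacent_vertices G u w" "adjacent_vertices G u v" "adjacent_vertices G w s" "v \<noteq> w" "s \<noteq> u"
      using adjacent by auto
    show ?thesis
      using adj' dich not_all_neg other by blast
  qed
qed

end
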